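(* Let $M$ be a finitely generated, left cancellative monoid which is strongly $\delta$-hyperbolic with respect to some finite generating set (for some real $\delta\ge 0$). Then the word problem for $M$ lies in $\mathcal{NP}$.
   Context: Directed graphs may have loops and multiple edges; $d(u,v)$ is the length of a shortest directed path from $u$ to $v$ ($\infty$ if none). Out-ball $\overrightarrow{\mathcal{B}}_r(x)=\{y : d(x,y)\le r\}$, in-ball $\overleftarrow{\mathcal{B}}_r(x)=\{y : d(y,x)\le r\}$, extended to sets of vertices by union. A path $[x_0,\dots,x_n]$ (edge from $x_i$ to $x_{i+1}$) of length $n$ is a geodesic if $n=d(x_0,x_n)$. A directed geodesic triangle is an ordered triple $(p,q,r)$ of geodesics with the end of $p$ equal to the start of $q$, and the concatenation $p\circ q$ having the same start and end as $r$. It is $\delta$-thin if every vertex of $r$ lies in $\overrightarrow{\mathcal{B}}_\delta(p)\cup\overleftarrow{\mathcal{B}}_\delta(q)$, every vertex of $p$ lies in $\overrightarrow{\mathcal{B}}_\delta(r)\cup\overleftarrow{\mathcal{B}}_\delta(q)$, and every vertex of $q$ lies in $\overrightarrow{\mathcal{B}}_\delta(p)\cup\overleftarrow{\mathcal{B}}_\delta(r)$. A directed graph is strongly $\delta$-hyperbolic if all its directed geodesic triangles are $\delta$-thin. For a monoid $M$ generated by a finite set $A$, the right Cayley graph has vertex set $M$ and an edge $m\to n$ for each $a\in A$ with $ma=n$; $M$ is strongly $\delta$-hyperbolic with respect to $A$ if this graph is. The word problem asks, given two words over a finite generating set, whether they represent the same element. *)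

theory Defs
  imports Main "HOL-Library.Extended_Nat"
begin

definition cg_edge :: "'m::monoid_mult set \<Rightarrow> 'm \<Rightarrow> 'm \<Rightarrow> bool" where
  "cg_edge A m n \<longleftrightarrow> (\<exists>a\<in>A. m * a = n)"

definition cg_path :: "'m::monoid_mult set \<Rightarrow> 'm list \<Rightarrow> bool" where
  "cg_path A p \<longleftrightarrow> p \<noteq> [] \<and> (\<forall>i. Suc i < length p \<longrightarrow> cg_edge A (p ! i) (p ! Suc i))"

definition cg_dist :: "'m::monoid_mult set \<Rightarrow> 'm \<Rightarrow> 'm \<Rightarrow> enat" where
  "cg_dist A x y = Inf {enat (length p - 1) | p. cg_path A p \<and> hd p = x \<and> last p = y}"

definition cg_geodesic :: "'m::monoid_mult set \<Rightarrow> 'm list \<Rightarrow> bool" where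
  "cg_geodesic A p \<longleftrightarrow> cg_path A p \<and> enat (length p - 1) = cg_dist A (hd p) (last p)"

definition dist_le :: "'m::monoid_mult set \<Rightarrow> 'm \<Rightarrow> 'm \<Rightarrow> real \<Rightarrow> bool" where
  "dist_le A x y r \<longleftrightarrow> (\<exists>n. cg_dist A x y = enat n \<and> real n \<le> r)"

definition out_ball :: "'m::monoid_mult set \<Rightarrow> real \<Rightarrow> 'm set \<Rightarrow> 'm set" where
  "out_ball A r S = {y. \<exists>x\<in>S. dist_le A x y r}"

definition in_ball :: "'m::monoid_mult set \<Rightarrow> real \<Rightarrow> 'm set \<Rightarrow> 'm set" where
  "in_ball A r S = {y. \<exists>x\<in>S. dist_le A y x r}"

definition geodesic_triangle :: "'m::monoid_mult set \<Rightarrow> 'm list \<Rightarrow> 'm list \<Rightarrow> 'm list \<Rightarrow> bool" where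
  "geodesic_triangle A p q r \<longleftrightarrow>
     cg_geodesic A p \<and> cg_geodesic A q \<and> cg_geodesic A r \<and>
     last p = hd q \<and> hd r = hd p \<and> last r = last q"

definition thin_triangle :: "'m::monoid_mult set \<Rightarrow> real \<Rightarrow> 'm list \<Rightarrow> 'm list \<Rightarrow> 'm list \<Rightarrow> bool" where
  "thin_triangle A \<delta> p q r \<longleftrightarrow>
     set r \<subseteq> out_ball A \<delta> (set p) \<union> in_ball A \<delta> (set q) \<and>
     set p \<subseteq> out_ball A \<delta> (set r) \<union> in_ball A \<delta> (set q) \<and>
     set q \<subseteq> out_ball A \<delta> (set p) \<union> in_ball A \<delta> (set r)"

definition strongly_hyperbolic :: "'m::monoid_mult set \<Rightarrow> real \<Rightarrow> bool" where
  "strongly_hyperbolic A \<delta> \<longleftrightarrow>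
     (\<forall>p q r. geodesic_triangle A p q r \<longrightarrow> thin_triangle A \<delta> p q r)"

definition generates :: "'m::monoid_mult set \<Rightarrow> bool" where
  "generates A \<longleftrightarrow> (\<forall>m. \<exists>w. set w \<subseteq> A \<and> prod_list w = m)"

definition word_problem :: "'m::monoid_mult set \<Rightarrow> 'm option list set" where
  "word_problem B = {map Some u @ [None] @ map Some v | u v.
      set u \<subseteq> B \<and> set v \<subseteq> B \<and> prod_list u = prod_list v}"

text \<open>Configuration: (state, tape, head position). Blank symbol is 0.
  Transitions (q, read, q', write, move) with move in {-1,0,1}.\<close>
type_synonym config = "nat \<times> (int \<Rightarrow> nat) \<times> int"

definition ntm_step :: "(nat \<times> nat \<times> nat \<times> nat \<times> int) set \<Rightarrow> config \<Rightarrow> config \<Rightarrow> bool" where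
  "ntm_step \<Delta> c c' \<longleftrightarrow> (\<exists>q t h q' b d. c = (q, t, h) \<and> (q, t h, q', b, d) \<in> \<Delta> \<and>
      c' = (q', t(h := b), h + d))"

definition ntm_init :: "('s \<Rightarrow> nat) \<Rightarrow> nat \<Rightarrow> 's list \<Rightarrow> config" where
  "ntm_init enc q0 w = (q0, \<lambda>i. if 0 \<le> i \<and> i < int (length w) then enc (w ! nat i) else 0, 0)"

definition ntm_accepts_within ::
  "(nat \<times> nat \<times> nat \<times> nat \<times> int) set \<Rightarrow> nat \<Rightarrow> nat set \<Rightarrow> ('s \<Rightarrow> nat) \<Rightarrow> 's list \<Rightarrow> nat \<Rightarrow> bool" where
  "ntm_accepts_within \<Delta> q0 F enc w T \<longleftrightarrow>
     (\<exists>k c. k \<le> T \<and> (ntm_step \<Delta> ^^ k) (ntm_init enc q0 w) c \<and> fst c \<in> F)"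

definition in_NP :: "'s set \<Rightarrow> 's list set \<Rightarrow> bool" where
  "in_NP \<Sigma> L \<longleftrightarrow> finite \<Sigma> \<and>
     (\<exists>Q \<Gamma> \<Delta> q0 F enc (c::nat) (k::nat).
        finite Q \<and> finite \<Gamma> \<and> 0 \<in> \<Gamma> \<and> q0 \<in> Q \<and> F \<subseteq> Q \<and>
        \<Delta> \<subseteq> Q \<times> \<Gamma> \<times> Q \<times> \<Gamma> \<times> {-1, 0, 1} \<and>
        inj_on enc \<Sigma> \<and> enc ` \<Sigma> \<subseteq> \<Gamma> - {0} \<and>
        (\<forall>w \<in> lists \<Sigma>. w \<in> L \<longleftrightarrow> ntm_accepts_within \<Delta> q0 F enc w (c * (length w + 1) ^ k)))"

end

theory Submission
  imports Defs Complex_Main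
begin

text \<open>
  By left cancellativity, geodesics of the Cayley graph are translates of geodesic words, and a
  directed geodesic triangle is an equation \<open>p q = r\<close> between geodesic words. Cutting the longer of
  \<open>p\<close> and \<open>q\<close> in the middle, thinness yields a short word \<open>s\<close> and decomposes the triangle into three
  others. At most one of them fails to be smaller by a constant factor; one of its first two sides
  is the short word \<open>s\<close>, and cutting it once more makes all the pieces smaller. So a
  triangle of size \<open>n\<close> is filled by at most \<open>5 ^ i\<close> bounded relations with \<open>i\<close> logarithmic in \<open>n\<close>, and
  equal words are connected by polynomially many applications of relations of bounded length.

  A nondeterministic machine guesses such a derivation. Each application of a relation is one sweep
  over the tape during which the machine carries a monoid element \<open>s\<close> from a fixed finite set: reading
  \<open>a\<close> it may write \<open>b\<close> and go on with \<open>t\<close> whenever \<open>s a = b t\<close>, so that the product of the tape with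
  the carried element inserted at the head never changes.
\<close>

section \<open>Bounded rewriting\<close>

text \<open>No presentation is fixed: the relations applied are all true equations between words of
  length at most \<open>K\<close> over \<open>C\<close>.\<close>

definition rewrite_step :: "'m::monoid_mult set \<Rightarrow> nat \<Rightarrow> 'm list \<Rightarrow> 'm list \<Rightarrow> bool" where
  "rewrite_step C K u v \<longleftrightarrow> (\<exists>x l r y. u = x @ l @ y \<and> v = x @ r @ y \<and>
     set l \<subseteq> C \<and> set r \<subseteq> C \<and> length l \<le> K \<and> length r \<le> K \<and> prod_list l = prod_list r)"

definition derives :: "'m::monoid_mult set \<Rightarrow> nat \<Rightarrow> nat \<Rightarrow> 'm list \<Rightarrow> 'm list \<Rightarrow> bool" where
  "derives C K n u v \<longleftrightarrow> (\<exists>j\<le>n. (rewrite_step C K ^^ j) u v)"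

lemma rewrite_step_sym: "rewrite_step C K u v \<Longrightarrow> rewrite_step C K v u"
  unfolding rewrite_step_def by metis

lemma rewrite_step_context: "rewrite_step C K u v \<Longrightarrow> rewrite_step C K (x @ u @ y) (x @ v @ y)"
  unfolding rewrite_step_def by (metis append.assoc)

lemma derives_refl: "derives C K n u u"
  unfolding derives_def by (rule exI[of _ 0]) simp

lemma derives_mono: "derives C K n u v \<Longrightarrow> n \<le> m \<Longrightarrow> derives C K m u v"
  unfolding derives_def by (meson le_trans)

lemma derives_trans: "derives C K n u v \<Longrightarrow> derives C K m v w \<Longrightarrow> derives C K (n + m) u w"
  unfolding derives_def by (meson add_mono relpowp_trans)

lemma derives_sym:
  assumes "derives C K n u v"
  shows "derives C K n v u"
proof -
  have "(rewrite_step C K ^^ j) u v \<Longrightarrow> (rewrite_step C K ^^ j) v u" for j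
  proof (induction j arbitrary: v)
    case (Suc j)
    then obtain w where "(rewrite_step C K ^^ j) u w" "rewrite_step C K w v" by auto
    then show ?case using Suc.IH rewrite_step_sym relpowp_Suc_I2 by metis
  qed simp
  then show ?thesis using assms unfolding derives_def by blast
qed

lemma derives_context:
  assumes "derives C K n u v"
  shows "derives C K n (x @ u @ y) (x @ v @ y)"
proof -
  have "(rewrite_step C K ^^ j) u v \<Longrightarrow> (rewrite_step C K ^^ j) (x @ u @ y) (x @ v @ y)" for j
  proof (induction j arbitrary: v)
    case (Suc j)
    then obtain w where "(rewrite_step C K ^^ j) u w" "rewrite_step C K w v" by auto
    then show ?case using Suc.IH rewrite_step_context relpowp_Suc_I by metis
  qed simp
  then show ?thesis using assms unfolding derives_def by blast
qed

lemma derives_relation: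
  assumes "set l \<subseteq> C" "set r \<subseteq> C" "length l \<le> K" "length r \<le> K" "prod_list l = prod_list r"
  shows "derives C K 1 l r"
proof -
  have "rewrite_step C K l r"
    unfolding rewrite_step_def using assms by (intro exI[of _ "[]"] exI[of _ l] exI[of _ r]) simp
  then have "(rewrite_step C K ^^ 1) l r" by (subst relpowp_1)
  then show ?thesis unfolding derives_def by (intro exI[of _ 1]) simp
qed

text \<open>Assembles the fillings of a triangle cut by a chord \<open>s\<close> from its third side
  to its first. The piece \<open>r1 s = p1\<close> is used backwards to expose \<open>s\<close>;
  then \<open>s p2\<close> is folded into \<open>t\<close>, and \<open>t q\<close> into
  \<open>r2\<close>.\<close>

lemma derives_join_first:
  assumes "derives C K a (r1 @ s) p1" "derives C K b (s @ p2) t" "derives C K c (t @ q) r2"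
  shows "derives C K (a + b + c) ((p1 @ p2) @ q) (r1 @ r2)"
proof -
  have "derives C K a ((p1 @ p2) @ q) (r1 @ s @ p2 @ q)"
    using derives_context[OF derives_sym[OF assms(1)], of "[]" "p2 @ q"] by simp
  moreover have "derives C K b (r1 @ s @ p2 @ q) (r1 @ t @ q)"
    using derives_context[OF assms(2), of r1 q] by simp
  moreover have "derives C K c (r1 @ t @ q) (r1 @ r2)"
    using derives_context[OF assms(3), of r1 "[]"] by simp
  ultimately show ?thesis using derives_trans by metis
qed

text \<open>Here the chord \<open>s\<close> cuts off the corner where the first two sides meet. That
  corner is filled first, and \<open>t\<close> divides what is left.\<close>

lemma derives_join_middle:
  assumes "derives C K a (p2 @ q1) s" "derives C K b (s @ q2) t" "derives C K c (p1 @ t) r"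
  shows "derives C K (a + b + c) ((p1 @ p2) @ q1 @ q2) r"
proof -
  have "derives C K a ((p1 @ p2) @ q1 @ q2) (p1 @ s @ q2)"
    using derives_context[OF assms(1), of p1 q2] by simp
  moreover have "derives C K b (p1 @ s @ q2) (p1 @ t)"
    using derives_context[OF assms(2), of p1 "[]"] by simp
  ultimately show ?thesis using derives_trans assms(3) by metis
qed

text \<open>Here the chord \<open>s\<close> runs from the second side to the third. The piece
  \<open>s r2 = q2\<close> is used backwards, so that \<open>s\<close> appears next to
  \<open>q1\<close> and both are absorbed into \<open>t\<close>.\<close>

lemma derives_join_last:
  assumes "derives C K a (q1 @ s) t" "derives C K b (p @ t) r1" "derives C K c (s @ r2) q2"
  shows "derives C K (a + b + c) (p @ q1 @ q2) (r1 @ r2)"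
proof -
  have "derives C K c (p @ q1 @ q2) (p @ q1 @ s @ r2)"
    using derives_context[OF derives_sym[OF assms(3)], of "p @ q1" "[]"] by simp
  moreover have "derives C K a (p @ q1 @ s @ r2) (p @ t @ r2)"
    using derives_context[OF assms(1), of p r2] by simp
  moreover have "derives C K b (p @ t @ r2) (r1 @ r2)"
    using derives_context[OF assms(2), of "[]" r2] by simp
  ultimately have "derives C K (c + a + b) (p @ q1 @ q2) (r1 @ r2)" using derives_trans by metis
  then show ?thesis by (simp add: ac_simps)
qed

section \<open>Geodesic words and paths in the Cayley graph\<close>

definition geodesic_word :: "'m::monoid_mult set \<Rightarrow> 'm list \<Rightarrow> bool" where
  "geodesic_word A w \<longleftrightarrow> set w \<subseteq> A \<and>
     (\<forall>w'. set w' \<subseteq> A \<and> prod_list w' = prod_list w \<longrightarrow> length w \<le> length w')"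

lemma geodesic_wordD: "geodesic_word A w \<Longrightarrow> set w \<subseteq> A"
  unfolding geodesic_word_def by blast

text \<open>A shorter word with the product of a factor could be substituted for that factor and
  would shorten the whole word.\<close>

lemma geodesic_word_append:
  assumes "geodesic_word A (u @ v)"
  shows "geodesic_word A u" "geodesic_word A v"
proof -
  show "geodesic_word A u" unfolding geodesic_word_def
  proof (intro conjI allI impI)
    show "set u \<subseteq> A" using assms by (auto simp: geodesic_word_def)
    fix w assume "set w \<subseteq> A \<and> prod_list w = prod_list u"
    then have "set (w @ v) \<subseteq> A \<and> prod_list (w @ v) = prod_list (u @ v)"
      using assms by (auto simp: geodesic_word_def)
    then have "length (u @ v) \<le> length (w @ v)" using assms unfolding geodesic_word_def by blast
    then show "length u \<le> length w" by simp
  qed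
  show "geodesic_word A v" unfolding geodesic_word_def
  proof (intro conjI allI impI)
    show "set v \<subseteq> A" using assms by (auto simp: geodesic_word_def)
    fix w assume "set w \<subseteq> A \<and> prod_list w = prod_list v"
    then have "set (u @ w) \<subseteq> A \<and> prod_list (u @ w) = prod_list (u @ v)"
      using assms by (auto simp: geodesic_word_def)
    then have "length (u @ v) \<le> length (u @ w)" using assms unfolding geodesic_word_def by blast
    then show "length v \<le> length w" by simp
  qed
qed

lemma geodesic_word_exists:
  assumes "set w \<subseteq> A"
  obtains g where "geodesic_word A g" "prod_list g = prod_list w" "length g \<le> length w"
proof -
  let ?P = "\<lambda>g. set g \<subseteq> A \<and> prod_list g = prod_list w"
  define g where "g = arg_min length ?P"
  have g: "?P g" and m: "\<And>x. ?P x \<Longrightarrow> length g \<le> length x"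
    using arg_min_nat_lemma[of ?P w length] assms unfolding g_def by auto
  show thesis using that[of g] g m assms unfolding geodesic_word_def by auto
qed

lemma cg_path_word:
  "cg_path A p \<Longrightarrow> \<exists>w. set w \<subseteq> A \<and> length w = length p - 1 \<and> hd p * prod_list w = last p"
proof (induction p)
  case (Cons x p)
  show ?case
  proof (cases p)
    case Nil
    then show ?thesis by (intro exI[of _ "[]"]) simp
  next
    case (Cons y p')
    have e: "\<And>i. Suc i < length (x # p) \<Longrightarrow> cg_edge A ((x # p) ! i) ((x # p) ! Suc i)"
      using Cons.prems unfolding cg_path_def by blast
    have "cg_path A p" unfolding cg_path_def using Cons e[of "Suc _"] by auto
    then obtain w where w: "set w \<subseteq> A" "length w = length p - 1" "hd p * prod_list w = last p"
      using Cons.IH by blast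
    obtain a where "a \<in> A" "x * a = hd p" using e[of 0] Cons unfolding cg_edge_def by auto
    then show ?thesis using w Cons by (intro exI[of _ "a # w"]) (auto simp: mult.assoc[symmetric])
  qed
qed (simp add: cg_path_def)

definition word_path :: "'m::monoid_mult \<Rightarrow> 'm list \<Rightarrow> 'm list" where
  "word_path x w = map (\<lambda>i. x * prod_list (take i w)) [0..<Suc (length w)]"

lemma word_path_ends: "hd (word_path x w) = x" "last (word_path x w) = x * prod_list w"
  unfolding word_path_def by (simp_all add: hd_map last_map del: upt_Suc)

lemma length_word_path: "length (word_path x w) = Suc (length w)"
  unfolding word_path_def by simp

text \<open>Lets a vertex supplied by thinness be read as a place at which the word is cut.\<close>

lemma word_path_mem: "y \<in> set (word_path x w) \<longleftrightarrow> (\<exists>w1 w2. w = w1 @ w2 \<and> y = x * prod_list w1)"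
proof
  assume "y \<in> set (word_path x w)"
  then obtain i where "y = x * prod_list (take i w)"
    unfolding word_path_def set_map by blast
  then show "\<exists>w1 w2. w = w1 @ w2 \<and> y = x * prod_list w1" by (metis append_take_drop_id)
next
  assume "\<exists>w1 w2. w = w1 @ w2 \<and> y = x * prod_list w1"
  then obtain w1 w2 where "w = w1 @ w2" "y = x * prod_list w1" by blast
  then show "y \<in> set (word_path x w)"
    unfolding word_path_def by (auto simp del: upt_Suc intro!: image_eqI[of _ _ "length w1"])
qed

lemma cg_path_word_path:
  assumes "set w \<subseteq> A"
  shows "cg_path A (word_path x w)"
proof -
  have "cg_edge A (word_path x w ! i) (word_path x w ! Suc i)" if "i < length w" for i
    using that assms nth_mem[of i w] unfolding cg_edge_def word_path_def
    by (auto simp del: upt_Suc simp: take_Suc_conv_app_nth mult.assoc intro!: bexI[of _ "w ! i"])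
  moreover have "word_path x w \<noteq> []" by (metis length_word_path list.size(3) nat.distinct(1))
  ultimately show ?thesis unfolding cg_path_def by (auto simp: length_word_path)
qed

text \<open>A finite infimum is not that of the empty set, so it is attained in the well-order of
  the extended naturals; the labels along a path attaining it form the word.\<close>

lemma cg_dist_eq_enat:
  assumes "cg_dist A x y = enat n"
  obtains w where "set w \<subseteq> A" "length w = n" "x * prod_list w = y"
proof -
  let ?S = "{enat (length p - 1) | p. cg_path A p \<and> hd p = x \<and> last p = y}"
  have "?S \<noteq> {}"
  proof
    assume "?S = {}"
    then have "cg_dist A x y = \<infinity>" unfolding cg_dist_def by (simp only: Inf_empty top_enat_def)
    then show False using assms by simp
  qed
  then obtain e where "e \<in> ?S" by blast
  then have "Inf ?S \<in> ?S" by (rule wellorder_InfI)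
  then obtain p where "cg_path A p" "hd p = x" "last p = y" "length p - 1 = n"
    using assms unfolding cg_dist_def by auto
  then show thesis using cg_path_word[of A p] that by metis
qed

section \<open>Filling thin triangles\<close>

locale thin_triangles =
  fixes A :: "'m::monoid_mult set" and \<delta> :: real
  assumes cancel: "\<And>a b c::'m. a * b = a * c \<Longrightarrow> b = c"
    and generating: "generates A"
    and hyperbolic: "strongly_hyperbolic A \<delta>"
begin

text \<open>Distances are natural numbers, so those at most \<delta> are at most its integer
  part.\<close>

definition width :: nat where "width = nat \<lfloor>\<delta>\<rfloor>"

definition triangle :: "'m list \<Rightarrow> 'm list \<Rightarrow> 'm list \<Rightarrow> bool" where
  "triangle p q r \<longleftrightarrow> geodesic_word A p \<and> geodesic_word A q \<and> geodesic_word A r \<and>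
     prod_list p * prod_list q = prod_list r"

lemma geodesic_of: obtains g where "geodesic_word A g" "prod_list g = m"
  using generating geodesic_word_exists unfolding generates_def by metis

text \<open>Left cancellation makes translates of geodesics geodesic: a path from \<open>x\<close>
  to \<open>x * prod_list w\<close> spells some \<open>w'\<close> with
  \<open>x * prod_list w' = x * prod_list w\<close>, so \<open>w'\<close> has the product of
  \<open>w\<close> and is no shorter.\<close>

lemma geodesic_word_path:
  assumes "geodesic_word A w"
  shows "cg_geodesic A (word_path x w)"
proof -
  let ?S = "{enat (length p - 1) | p. cg_path A p \<and> hd p = x \<and> last p = x * prod_list w}"
  have path: "cg_path A (word_path x w)" using assms cg_path_word_path unfolding geodesic_word_def by blast
  have "Inf ?S = enat (length w)"
  proof (rule antisym)
    show "Inf ?S \<le> enat (length w)"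
      using path by (intro Inf_lower CollectI exI[of _ "word_path x w"]) (simp add: word_path_ends length_word_path)
    show "enat (length w) \<le> Inf ?S"
    proof (rule Inf_greatest)
      fix e assume "e \<in> ?S"
      then obtain p where p: "e = enat (length p - 1)" "cg_path A p" "hd p = x" "last p = x * prod_list w"
        by blast
      then obtain w' where w': "set w' \<subseteq> A" "length w' = length p - 1" "x * prod_list w' = x * prod_list w"
        using cg_path_word by metis
      then have "prod_list w' = prod_list w" using cancel by blast
      then show "enat (length w) \<le> e" using assms w' p(1) unfolding geodesic_word_def by auto
    qed
  qed
  then show ?thesis using path unfolding cg_geodesic_def cg_dist_def
    by (simp add: word_path_ends length_word_path)
qed

lemma dist_le_geodesic:
  assumes "dist_le A x y \<delta>"
  obtains s where "geodesic_word A s" "length s \<le> width" "x * prod_list s = y"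
proof -
  obtain n where n: "cg_dist A x y = enat n" "real n \<le> \<delta>" using assms unfolding dist_le_def by blast
  then obtain w where w: "set w \<subseteq> A" "length w = n" "x * prod_list w = y" by (metis cg_dist_eq_enat)
  moreover have "n \<le> width" using n(2) unfolding width_def by linarith
  ultimately show thesis using geodesic_word_exists[OF w(1)] that by (metis le_trans)
qed

text \<open>The equation is drawn with its initial corner at 1: \<open>p\<close> and
  \<open>r\<close> start at 1, and \<open>q\<close> starts where \<open>p\<close> ends.\<close>

lemma triangle_thin:
  assumes "triangle p q r"
  shows "thin_triangle A \<delta> (word_path 1 p) (word_path (prod_list p) q) (word_path 1 r)"
  using assms hyperbolic geodesic_word_path unfolding strongly_hyperbolic_def triangle_def
  by (auto simp: geodesic_triangle_def word_path_ends)

section \<open>Cutting triangles along short chords\<close>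

lemma triangleE:
  assumes "geodesic_word A u" "geodesic_word A v"
  obtains t where "triangle u v t" "length t \<le> length u + length v"
proof -
  have "set (u @ v) \<subseteq> A" using assms unfolding geodesic_word_def by auto
  then obtain t where "geodesic_word A t" "prod_list t = prod_list (u @ v)" "length t \<le> length (u @ v)"
    by (rule geodesic_word_exists)
  then show thesis using assms that[of t] unfolding triangle_def by simp
qed

text \<open>The word \<open>p @ q\<close> competes with the geodesic \<open>r\<close>. Hence the
  first two sides control the third and can serve as the size of a triangle.\<close>

lemma triangle_length: "triangle p q r \<Longrightarrow> length r \<le> length p + length q"
proof -
  assume "triangle p q r"
  then have "geodesic_word A r" "set (p @ q) \<subseteq> A \<and> prod_list (p @ q) = prod_list r"
    unfolding triangle_def geodesic_word_def by auto
  then have "length r \<le> length (p @ q)" unfolding geodesic_word_def by blast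
  then show ?thesis by simp
qed

text \<open>Thinness is applied to the vertex between \<open>p1\<close> and \<open>p2\<close>: a
  short word \<open>s\<close> leads either to it from a vertex of \<open>r\<close> or from it to a
  vertex of \<open>q\<close>. The geodesic \<open>t\<close> is a diagonal of the remaining
  quadrilateral, and cancelling a common prefix gives the missing equation.\<close>

lemma split_first:
  assumes "triangle (p1 @ p2) q r"
  obtains (opposite) r1 r2 s t where "r = r1 @ r2" "length s \<le> width" "length t \<le> length s + length p2"
      "triangle r1 s p1" "triangle s p2 t" "triangle t q r2"
  | (adjacent) q1 q2 s t where "q = q1 @ q2" "length s \<le> width" "length t \<le> length s + length q2"
      "triangle p2 q1 s" "triangle s q2 t" "triangle p1 t r"
proof -
  have g: "geodesic_word A p1" "geodesic_word A p2" "geodesic_word A q" "geodesic_word A r"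
    and e: "prod_list r = prod_list p1 * prod_list p2 * prod_list q"
    using assms geodesic_word_append unfolding triangle_def by (auto)
  have "prod_list p1 \<in> set (word_path 1 (p1 @ p2))" unfolding word_path_mem by force
  then consider (a) "prod_list p1 \<in> out_ball A \<delta> (set (word_path 1 r))"
    | (b) "prod_list p1 \<in> in_ball A \<delta> (set (word_path (prod_list (p1 @ p2)) q))"
    using triangle_thin[OF assms] unfolding thin_triangle_def by blast
  then show thesis
  proof cases
    case a
    then obtain r1 r2 where r: "r = r1 @ r2" "dist_le A (prod_list r1) (prod_list p1) \<delta>"
      unfolding out_ball_def by (auto simp: word_path_mem)
    then obtain s where s: "geodesic_word A s" "length s \<le> width" "prod_list r1 * prod_list s = prod_list p1"
      by (metis dist_le_geodesic)
    obtain t where t: "triangle s p2 t" "length t \<le> length s + length p2" using triangleE[OF s(1) g(2)] .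
    have gr: "geodesic_word A r1" "geodesic_word A r2" using g(4) r(1) geodesic_word_append by auto
    have "prod_list r1 * prod_list r2 = prod_list r1 * (prod_list t * prod_list q)"
      using e r(1) s(3) t(1) unfolding triangle_def by (simp add: mult.assoc[symmetric]) (metis mult.assoc)
    then have "prod_list t * prod_list q = prod_list r2" using cancel by metis
    then show thesis using opposite[of r1 r2 s t] r s t g gr unfolding triangle_def by auto
  next
    case b
    then obtain q1 q2 where q: "q = q1 @ q2" "dist_le A (prod_list p1) (prod_list (p1 @ p2) * prod_list q1) \<delta>"
      unfolding in_ball_def by (auto simp: word_path_mem)
    then obtain s where s: "geodesic_word A s" "length s \<le> width"
      "prod_list p1 * prod_list s = prod_list (p1 @ p2) * prod_list q1"
      by (metis dist_le_geodesic)
    have gq: "geodesic_word A q1" "geodesic_word A q2" using g(3) q(1) geodesic_word_append by auto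
    obtain t where t: "triangle s q2 t" "length t \<le> length s + length q2" using triangleE[OF s(1) gq(2)] .
    have s': "prod_list p2 * prod_list q1 = prod_list s"
      using s(3) cancel by (metis mult.assoc prod_list.append)
    then have "prod_list p1 * prod_list t = prod_list r"
      using e q(1) t(1) unfolding triangle_def by (simp add: mult.assoc) (metis mult.assoc)
    then show thesis using adjacent[of q1 q2 s t] q s s' t g gq unfolding triangle_def by auto
  qed
qed

text \<open>Thinness is applied to the vertex between \<open>q1\<close> and \<open>q2\<close>: a
  short word \<open>s\<close> leads either to it from a vertex of \<open>p\<close>, cutting off the
  corner of \<open>p\<close> and \<open>q\<close>, or from it to a vertex of \<open>r\<close>. Again
  \<open>t\<close> is a diagonal of the remaining quadrilateral.\<close>

lemma split_second:
  assumes "triangle p (q1 @ q2) r"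
  obtains (adjacent) p1 p2 s t where "p = p1 @ p2" "length s \<le> width" "length t \<le> length s + length q2"
      "triangle p2 q1 s" "triangle s q2 t" "triangle p1 t r"
  | (opposite) r1 r2 s t where "r = r1 @ r2" "length s \<le> width" "length t \<le> length q1 + length s"
      "triangle q1 s t" "triangle p t r1" "triangle s r2 q2"
proof -
  have g: "geodesic_word A q1" "geodesic_word A q2" "geodesic_word A p" "geodesic_word A r"
    and e: "prod_list r = prod_list p * prod_list q1 * prod_list q2"
    using assms geodesic_word_append unfolding triangle_def by (auto simp: mult.assoc)
  have "prod_list p * prod_list q1 \<in> set (word_path (prod_list p) (q1 @ q2))" unfolding word_path_mem by blast
  then consider (a) "prod_list p * prod_list q1 \<in> out_ball A \<delta> (set (word_path 1 p))"
    | (b) "prod_list p * prod_list q1 \<in> in_ball A \<delta> (set (word_path 1 r))"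
    using triangle_thin[OF assms] unfolding thin_triangle_def by blast
  then show thesis
  proof cases
    case a
    then obtain p1 p2 where p: "p = p1 @ p2" "dist_le A (prod_list p1) (prod_list p * prod_list q1) \<delta>"
      unfolding out_ball_def by (auto simp: word_path_mem)
    then obtain s where s: "geodesic_word A s" "length s \<le> width"
      "prod_list p1 * prod_list s = prod_list p * prod_list q1"
      by (metis dist_le_geodesic)
    obtain t where t: "triangle s q2 t" "length t \<le> length s + length q2" using triangleE[OF s(1) g(2)] .
    have gp: "geodesic_word A p1" "geodesic_word A p2" using g(3) p(1) geodesic_word_append by auto
    have s': "prod_list p2 * prod_list q1 = prod_list s"
      using s(3) p(1) cancel by (metis mult.assoc prod_list.append)
    then have "prod_list p1 * prod_list t = prod_list r"
      using e s(3) t(1) unfolding triangle_def by (metis mult.assoc)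
    then show thesis using adjacent[of p1 p2 s t] p s s' t g gp unfolding triangle_def by auto
  next
    case b
    then obtain r1 r2 where r: "r = r1 @ r2" "dist_le A (prod_list p * prod_list q1) (prod_list r1) \<delta>"
      unfolding in_ball_def by (auto simp: word_path_mem)
    then obtain s where s: "geodesic_word A s" "length s \<le> width"
      "prod_list p * prod_list q1 * prod_list s = prod_list r1"
      by (metis dist_le_geodesic)
    obtain t where t: "triangle q1 s t" "length t \<le> length q1 + length s" using triangleE[OF g(1) s(1)] .
    have gr: "geodesic_word A r1" "geodesic_word A r2" using g(4) r(1) geodesic_word_append by auto
    have "prod_list p * prod_list q1 * (prod_list s * prod_list r2) = prod_list p * prod_list q1 * prod_list q2"
      using e r(1) s(3) by (metis mult.assoc prod_list.append)
    then have "prod_list s * prod_list r2 = prod_list q2" using cancel by blast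
    moreover have "prod_list p * prod_list t = prod_list r1"
      using s(3) t(1) unfolding triangle_def by (metis mult.assoc)
    ultimately show thesis using opposite[of r1 r2 s t] r s t g gr unfolding triangle_def by auto
  qed
qed

section \<open>Filling by repeated cutting\<close>

definition fillable :: "'m set \<Rightarrow> nat \<Rightarrow> nat \<Rightarrow> nat \<Rightarrow> bool" where
  "fillable C K m F \<longleftrightarrow>
     (\<forall>p q r. triangle p q r \<and> length p + length q \<le> m \<longrightarrow> derives C K F (p @ q) r)"

lemma fillableD:
  "fillable C K m F \<Longrightarrow> triangle p q r \<Longrightarrow> length p + length q \<le> m \<Longrightarrow> derives C K F (p @ q) r"
  unfolding fillable_def by blast

lemma fillable_mono: "fillable C K n F \<Longrightarrow> F \<le> F' \<Longrightarrow> fillable C K n F'"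
  unfolding fillable_def by (meson derives_mono)

lemma halve: obtains u v where "w = u @ v" "2 * length u \<le> length w + 1" "2 * length v \<le> length w + 1"
  by (rule that[of "take (length w div 2) w" "drop (length w div 2) w"]) simp_all

text \<open>
  The piece that fails to shrink under \<open>split_first\<close> has a short second side, and its third side is half
  of the side that was cut; this is what makes a second cut effective.
\<close>

lemma fill_short_second:
  assumes "fillable C K m F" "triangle p q r" "length q \<le> width"
    and "length p \<le> n" "2 * length r \<le> n + 1" "n + 1 + 4 * width \<le> 2 * m"
  shows "derives C K (F + F + F) (p @ q) r"
proof -
  note fill = fillableD[OF assms(1)]
  obtain p1 p2 where p: "p = p1 @ p2" "2 * length p1 \<le> length p + 1" "2 * length p2 \<le> length p + 1"
    by (rule halve)
  have "triangle (p1 @ p2) q r" using assms(2) p by simp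
  then show ?thesis
  proof (cases rule: split_first)
    \<comment> \<open>In both cases the first two sides of every piece have total length at most
      \<open>(n + 1) / 2 + 2 * width\<close>, which the last hypothesis bounds by
      \<open>m\<close>.\<close>
    case (opposite r1 r2 s t)
    show ?thesis unfolding p(1) opposite(1)
      using opposite p assms(3-6) by (intro derives_join_first[of _ _ _ _ s _ _ _ t] fill) auto
  next
    case (adjacent q1 q2 s t)
    show ?thesis unfolding p(1) adjacent(1)
      using adjacent p assms(3-6) by (intro derives_join_middle[of _ _ _ _ _ s _ _ t] fill) auto
  qed
qed

text \<open>The mirror image for \<open>split_second\<close>, whose piece \<open>s r2 = q2\<close>
  has a short first side and a third side that is half of the side cut. Halving its second side
  leaves pieces of size at most \<open>(n + 1) / 2 + 2 * width\<close>.\<close>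

lemma fill_short_first:
  assumes "fillable C K m F" "triangle p q r" "length p \<le> width"
    and "length q \<le> n" "2 * length r \<le> n + 1" "n + 1 + 4 * width \<le> 2 * m"
  shows "derives C K (F + F + F) (p @ q) r"
proof -
  note fill = fillableD[OF assms(1)]
  obtain q1 q2 where q: "q = q1 @ q2" "2 * length q1 \<le> length q + 1" "2 * length q2 \<le> length q + 1"
    by (rule halve)
  have "triangle p (q1 @ q2) r" using assms(2) q by simp
  then show ?thesis
  proof (cases rule: split_second)
    case (adjacent p1 p2 s t)
    show ?thesis unfolding q(1) adjacent(1)
      using adjacent q assms(3-6) by (intro derives_join_middle[of _ _ _ _ _ s _ _ t] fill) auto
  next
    case (opposite r1 r2 s t)
    show ?thesis unfolding q(1) opposite(1)
      using opposite q assms(3-6) by (intro derives_join_last[of _ _ _ _ s t] fill) auto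
  qed
qed

text \<open>Half of the longer side together with the whole shorter side is at most three quarters
  of \<open>n\<close>, up to a constant. Only the piece \<open>r1 s = p1\<close> or
  \<open>s r2 = q2\<close> can stay large, since it contains part of the third side; it costs
  \<open>3 * F\<close> after a second cut, and the other two pieces cost \<open>F\<close>
  each.\<close>

lemma fillable_step:
  assumes "fillable C K m F" and "3 * n + 4 * (2 * width + 1) \<le> 4 * m"
  shows "fillable C K n (5 * F)"
  unfolding fillable_def
proof (intro allI impI, elim conjE)
  note fill = fillableD[OF assms(1)]
  fix p q r assume tri: "triangle p q r" and n: "length p + length q \<le> n"
  have r: "length r \<le> n" using triangle_length[OF tri] n by simp
  have F: "derives C K (5 * F) u v" if "derives C K (F + F + F) u v" for u v
    using derives_mono[OF that] by simp
  show "derives C K (5 * F) (p @ q) r"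
  proof (cases "length q \<le> length p")
    case True
    obtain p1 p2 where p: "p = p1 @ p2" "2 * length p1 \<le> length p + 1" "2 * length p2 \<le> length p + 1"
      by (rule halve)
    have "triangle (p1 @ p2) q r" using tri p by simp
    then show ?thesis
    proof (cases rule: split_first)
      case (opposite r1 r2 s t)
      \<comment> \<open>Here \<open>r1\<close> may be almost as long as \<open>n\<close>, but
        \<open>s\<close> is short and \<open>p1\<close> is half of \<open>p\<close>.\<close>
      have "derives C K (F + F + F) (r1 @ s) p1"
        using opposite p n r assms(2) by (intro fill_short_second[OF assms(1), of _ _ _ n]) auto
      then have "derives C K ((F + F + F) + F + F) ((p1 @ p2) @ q) (r1 @ r2)"
        using opposite p n r assms(2) True by (intro derives_join_first[of _ _ _ _ s _ _ _ t] fill) auto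
      then show ?thesis using p(1) opposite(1) by (auto intro: derives_mono)
    next
      case (adjacent q1 q2 s t)
      show ?thesis unfolding p(1) adjacent(1)
        using adjacent p n True assms(2) by (intro F derives_join_middle[of _ _ _ _ _ s _ _ t] fill) auto
    qed
  next
    case False
    obtain q1 q2 where q: "q = q1 @ q2" "2 * length q1 \<le> length q + 1" "2 * length q2 \<le> length q + 1"
      by (rule halve)
    have "triangle p (q1 @ q2) r" using tri q by simp
    then show ?thesis
    proof (cases rule: split_second)
      case (adjacent p1 p2 s t)
      show ?thesis unfolding q(1) adjacent(1)
        using adjacent q n False assms(2) by (intro F derives_join_middle[of _ _ _ _ _ s _ _ t] fill) auto
    next
      case (opposite r1 r2 s t)
      have "derives C K (F + F + F) (s @ r2) q2"
        using opposite q n r assms(2) by (intro fill_short_first[OF assms(1), of _ _ _ n]) auto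
      then have "derives C K (F + F + (F + F + F)) (p @ q1 @ q2) (r1 @ r2)"
        using opposite q n r assms(2) False by (intro derives_join_last[of _ _ _ _ s t] fill) auto
      then show ?thesis using q(1) opposite(1) by (auto intro: derives_mono)
    qed
  qed
qed

definition base_size :: nat where "base_size = 8 * width + 9"

lemma fillable_base:
  assumes "A \<subseteq> C" "base_size \<le> K"
  shows "fillable C K base_size 1"
  unfolding fillable_def
proof (intro allI impI, elim conjE)
  fix p q r assume t: "triangle p q r" "length p + length q \<le> base_size"
  then show "derives C K 1 (p @ q) r"
    using triangle_length[OF t(1)] assms unfolding triangle_def geodesic_word_def
    by (intro derives_relation) auto
qed

text \<open>Passing from \<open>n\<close> to about \<open>3 * n / 4 + 2 * width\<close> shrinks the
  excess of \<open>n\<close> over \<open>8 * (width + 1)\<close> by the factor 3/4, so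
  \<open>i\<close> rounds of cutting cope with an excess of \<open>(4/3) ^ i\<close>.\<close>

lemma fillable_power:
  assumes "A \<subseteq> C" "base_size \<le> K"
  shows "real n \<le> 8 * (width + 1) + (4/3) ^ i \<Longrightarrow> fillable C K n (5 ^ i)"
proof (induction i arbitrary: n)
  case 0
  then have "n \<le> base_size" unfolding base_size_def by simp
  then show ?case using fillable_base[OF assms] unfolding fillable_def by auto
next
  case (Suc i)
  \<comment> \<open>This is the least \<open>m\<close> allowed by \<open>fillable_step\<close>:
    \<open>(3 * n + 8 * width + 4) / 4\<close> rounded up.\<close>
  define m where "m = (3 * n + 8 * width + 7) div 4"
  have "4 * m \<le> 3 * n + 8 * width + 7" unfolding m_def by simp
  then have "4 * real m \<le> 3 * real n + 8 * real width + 7" by linarith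
  then have "real m \<le> 8 * (width + 1) + (4/3) ^ i" using Suc.prems by simp
  then have "fillable C K m (5 ^ i)" by (rule Suc.IH)
  moreover have "3 * n + 4 * (2 * width + 1) \<le> 4 * m" unfolding m_def by simp
  ultimately show ?case using fillable_step by fastforce
qed

definition area :: "nat \<Rightarrow> nat" where "area n = (n + 1) ^ 6"

lemma area_mono: "m \<le> n \<Longrightarrow> area m \<le> area n"
  unfolding area_def by (rule power_mono) simp_all

lemma area_pos: "1 \<le> area n"
  unfolding area_def by (rule one_le_power) simp

text \<open>Allows the constant \<open>K\<close> to be moved out of the polynomial bound, because
  \<open>K * n + 1 \<le> (K + 1) * (n + 1)\<close>.\<close>

lemma area_scale: "m \<le> K * n \<Longrightarrow> area m \<le> area K * area n"
proof -
  assume "m \<le> K * n"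
  then have "m + 1 \<le> (K + 1) * (n + 1)" by simp
  then show ?thesis unfolding area_def power_mult_distrib[symmetric] by (rule power_mono) simp
qed

text \<open>The least sufficient depth \<open>i\<close> is logarithmic in \<open>n\<close>: depth
  \<open>i - 1\<close> fails, so \<open>(4/3) ^ (i - 1)\<close> is below \<open>n\<close>, and
  \<open>5 ^ i\<close> is polynomial.\<close>

lemma fillable_polynomial:
  assumes "A \<subseteq> C" "base_size \<le> K"
  shows "fillable C K n (5 * area n)"
proof -
  let ?P = "\<lambda>i. real n \<le> 8 * (width + 1) + (4/3) ^ i"
  have "\<exists>i. ?P i"
  proof -
    obtain i where "real n < (4/3) ^ i" using real_arch_pow[of "4/3" "real n"] by auto
    then have "?P i" by simp
    then show ?thesis by blast
  qed
  then obtain i where i: "?P i" and least: "\<And>j. j < i \<Longrightarrow> \<not> ?P j"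
    using exists_least_iff[of ?P] by blast
  have "5 ^ i \<le> 5 * area n"
  proof (cases i)
    case (Suc j)
    have "(4/3) ^ j \<le> real (n + 1)" using least[of j] Suc by simp
    then have "((4/3) ^ j) ^ 6 \<le> real (n + 1) ^ 6" by (rule power_mono) simp
    moreover have "((4/3) ^ j) ^ 6 = (((4/3) ^ 6) ^ j :: real)"
      by (simp only: power_mult[symmetric] mult.commute)
    \<comment> \<open>The exponent 6 of \<open>area\<close> comes from
      \<open>5 \<le> (4/3) ^ 6\<close>.\<close>
    moreover have "(5::real) ^ j \<le> ((4/3) ^ 6) ^ j"
      by (rule power_mono) (simp_all add: power_divide)
    ultimately have "(5::real) ^ j \<le> real (n + 1) ^ 6" by (simp only:)
    then have "real (5 ^ j) \<le> real (area n)" by (simp only: area_def of_nat_power of_nat_numeral)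
    then have "5 ^ j \<le> area n" by (simp only: of_nat_le_iff)
    then show ?thesis using Suc by simp
  qed (use area_pos[of n] in simp)
  then show ?thesis by (rule fillable_mono[OF fillable_power[OF assms i]])
qed

text \<open>The word is read letter by letter while its prefix is kept in geodesic form by the
  choice \<open>f\<close> of representatives. A new letter costs one relation and one triangle of
  size at most \<open>K * length (u @ [c])\<close>, together at most \<open>6 * area\<close> of that
  size.\<close>

lemma derives_geodesic:
  assumes C: "A \<subseteq> C" and K: "base_size \<le> K" "1 \<le> K"
    and f: "\<And>m. geodesic_word A (f m)" "\<And>m. prod_list (f m) = m"
    and short: "\<And>c. c \<in> C \<Longrightarrow> length (f c) \<le> K"
  shows "set u \<subseteq> C \<Longrightarrow> length (f (prod_list u)) \<le> K * length u \<and>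
     derives C K (length u * (6 * area (K * length u))) u (f (prod_list u))"
proof (induction u rule: rev_induct)
  case Nil
  have "length (f 1) \<le> length []"
    using f(1)[of 1] f(2)[of 1] unfolding geodesic_word_def by (elim conjE allE[of _ "[]"]) simp
  then show ?case using derives_refl by simp
next
  case (snoc c u)
  define g h t where "g = f (prod_list u)" and "h = f c" and "t = f (prod_list (u @ [c]))"
  have g: "length g \<le> K * length u" "derives C K (length u * (6 * area (K * length u))) u g"
    using snoc.IH snoc.prems unfolding g_def by (simp_all del: power_Suc)
  have h: "set h \<subseteq> C" "prod_list h = c" "length h \<le> K"
    using short[of c] snoc.prems f(1)[of c] f(2)[of c] C geodesic_wordD unfolding h_def by auto
  have t: "triangle g h t" unfolding triangle_def g_def h_def t_def by (simp add: f)
  let ?n = "K * length (u @ [c])"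
  have "derives C K (length u * (6 * area (K * length u))) (u @ [c]) (g @ [c])"
    using derives_context[OF g(2), of "[]" "[c]"] by simp
  \<comment> \<open>The letter \<open>c\<close> may lie outside \<open>A\<close>, so it is first
    exchanged for its geodesic representative.\<close>
  moreover have "derives C K 1 (g @ [c]) (g @ h)"
  proof -
    have "derives C K 1 [c] h" using h snoc.prems K by (intro derives_relation) auto
    from derives_context[OF this, of g "[]"] show ?thesis by simp
  qed
  moreover have "derives C K (5 * area ?n) (g @ h) t"
    using g h by (intro fillableD[OF fillable_polynomial[OF C K(1)] t]) simp
  ultimately have "derives C K (length u * (6 * area (K * length u)) + 1 + 5 * area ?n) (u @ [c]) t"
    by (rule derives_trans[OF derives_trans])
  moreover have "length u * (6 * area (K * length u)) + 1 + 5 * area ?n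
      \<le> length (u @ [c]) * (6 * area ?n)"
  proof -
    have "area (K * length u) \<le> area ?n" by (rule area_mono) simp
    then have "length u * (6 * area (K * length u)) \<le> length u * (6 * area ?n)" by simp
    moreover have "1 \<le> area ?n" by (rule area_pos)
    moreover have "length (u @ [c]) * (6 * area ?n) = length u * (6 * area ?n) + 6 * area ?n"
      by simp
    ultimately show ?thesis by linarith
  qed
  ultimately have "derives C K (length (u @ [c]) * (6 * area ?n)) (u @ [c]) t" by (rule derives_mono)
  moreover have "length t \<le> ?n" using triangle_length[OF t] g h by simp
  ultimately show ?case unfolding t_def by (rule conjI[rotated])
qed

text \<open>Both words reduce to the same geodesic representative, and one of the two reductions is
  reversed. The degree is 6 from \<open>area\<close> plus 1 for the number of letters.\<close>

lemma polynomial_derivations: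
  assumes "finite C" "A \<subseteq> C"
  obtains K c where
    "\<And>u v. set u \<subseteq> C \<Longrightarrow> set v \<subseteq> C \<Longrightarrow> prod_list u = prod_list v \<Longrightarrow>
       derives C K (c * (length u + length v + 1) ^ 7) u v"
proof -
  have "\<forall>m. \<exists>g. geodesic_word A g \<and> prod_list g = m" using geodesic_of by blast
  from choice[OF this] obtain f
    where f: "\<And>m. geodesic_word A (f m)" "\<And>m. prod_list (f m) = m" by blast
  \<comment> \<open>The sum is a crude bound on the lengths of the representatives of all
    letters.\<close>
  define K where "K = base_size + 1 + (\<Sum>c\<in>C. length (f c))"
  have short: "length (f c) \<le> K" if "c \<in> C" for c
    using member_le_sum[OF that _ assms(1), of "\<lambda>c. length (f c)"] unfolding K_def by simp
  have K: "base_size \<le> K" "1 \<le> K" unfolding K_def by simp_all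
  define M where "M = area K"
  have normal: "derives C K (6 * M * (n + 1) ^ 7) u (f (prod_list u))"
    if u: "set u \<subseteq> C" "length u \<le> n" for u n
  proof -
    have "area (K * length u) \<le> M * area n"
      unfolding M_def by (rule area_scale) (simp add: u(2))
    then have "length u * (6 * area (K * length u)) \<le> (n + 1) * (6 * (M * area n))"
      using u(2) by (intro mult_le_mono) auto
    moreover have "(n + 1) * (6 * (M * area n)) = 6 * M * (n + 1) ^ 7"
    proof -
      have "(n + 1) ^ 7 = (n + 1) * area n"
        unfolding area_def using power_Suc[of "n + 1" 6] by (simp only: eval_nat_numeral)
      then show ?thesis by (simp only: ac_simps)
    qed
    ultimately have "length u * (6 * area (K * length u)) \<le> 6 * M * (n + 1) ^ 7" by (simp only:)
    moreover have "derives C K (length u * (6 * area (K * length u))) u (f (prod_list u))"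
      using derives_geodesic[of C K f u, OF assms(2) K f short u(1)] by blast
    ultimately show ?thesis by (rule derives_mono[rotated])
  qed
  have "derives C K (12 * M * (length u + length v + 1) ^ 7) u v"
    if uv: "set u \<subseteq> C" "set v \<subseteq> C" "prod_list u = prod_list v" for u v
  proof -
    let ?n = "length u + length v"
    have "derives C K (6 * M * (?n + 1) ^ 7) u (f (prod_list v))"
      using normal[OF uv(1), of ?n] uv(3) by simp
    moreover have "derives C K (6 * M * (?n + 1) ^ 7) (f (prod_list v)) v"
      using derives_sym[OF normal[OF uv(2), of ?n]] by simp
    ultimately have "derives C K (6 * M * (?n + 1) ^ 7 + 6 * M * (?n + 1) ^ 7) u v"
      by (rule derives_trans)
    moreover have "6 * M * z + 6 * M * z = 12 * M * z" for z by simp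
    ultimately show ?thesis by (simp only:)
  qed
  then show thesis by (rule that)
qed

end

section \<open>Machines over arbitrary finite alphabets\<close>

text \<open>The blank is the outer \<open>None\<close>. When letters are themselves options, the
  separator on the tape is \<open>Some None\<close>.\<close>

definition tape_of :: "'g list \<Rightarrow> int \<Rightarrow> 'g option" where
  "tape_of T i = (if 0 \<le> i \<and> i < int (length T) then Some (T ! nat i) else None)"

definition machine_step ::
  "('q \<times> 'g option \<times> 'q \<times> 'g option \<times> int) set \<Rightarrow>
    'q \<times> (int \<Rightarrow> 'g option) \<times> int \<Rightarrow> 'q \<times> (int \<Rightarrow> 'g option) \<times> int \<Rightarrow> bool" where
  "machine_step \<Delta> c c' \<longleftrightarrow> (\<exists>q t h q' b d. c = (q, t, h) \<and> (q, t h, q', b, d) \<in> \<Delta> \<and>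
      c' = (q', t(h := b), h + d))"

lemma finite_inj_nat:
  assumes "finite Q"
  obtains f :: "'a \<Rightarrow> nat" where "inj_on f Q"
  using finite_imp_inj_to_nat_seg[OF assms] by auto

text \<open>States and letters are numbered injectively, and computations are transported in both
  directions. Soundness is asked for runs of any length, the time bound only for
  completeness.\<close>

lemma in_NP_machine:
  fixes Q :: "'q set" and G :: "'g set"
  assumes fin: "finite Q" "finite G" and sub: "q0 \<in> Q" "F \<subseteq> Q" "\<Sigma> \<subseteq> G"
    and \<Delta>: "\<Delta> \<subseteq> Q \<times> insert None (Some ` G) \<times> Q \<times> insert None (Some ` G) \<times> {-1, 0, 1}"
    and sound: "\<And>w k c. w \<in> lists \<Sigma> \<Longrightarrow> (machine_step \<Delta> ^^ k) (q0, tape_of w, 0) c \<Longrightarrow> fst c \<in> F \<Longrightarrow> w \<in> L"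
    and complete: "\<And>w. w \<in> lists \<Sigma> \<Longrightarrow> w \<in> L \<Longrightarrow>
      \<exists>k c. k \<le> a * (length w + 1) ^ b \<and> (machine_step \<Delta> ^^ k) (q0, tape_of w, 0) c \<and> fst c \<in> F"
  shows "in_NP \<Sigma> L"
proof -
  obtain eq :: "'q \<Rightarrow> nat" where eq: "inj_on eq Q" using fin(1) by (rule finite_inj_nat)
  obtain ef :: "'g \<Rightarrow> nat" where ef: "inj_on ef G" using fin(2) by (rule finite_inj_nat)
  \<comment> \<open>The successor keeps 0 free for the blank.\<close>
  define eg where "eg = case_option 0 (Suc \<circ> ef)"
  define G' where "G' = insert None (Some ` G)"
  have eg: "inj_on eg G'" using ef unfolding eg_def G'_def inj_on_def by auto
  define \<Delta>' where "\<Delta>' = (\<lambda>(q, a, q', b, d). (eq q, eg a, eq q', eg b, d)) ` \<Delta>"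
  define code :: "'q \<times> (int \<Rightarrow> 'g option) \<times> int \<Rightarrow> config" where "code = (\<lambda>(q, t, h). (eq q, eg \<circ> t, h))"
  \<comment> \<open>The numberings are injective only on \<open>Q\<close> and \<open>G'\<close>, so
    a coded step can be decoded only while the configuration stays inside them.\<close>
  define ok where "ok c \<longleftrightarrow> fst c \<in> Q \<and> range (fst (snd c)) \<subseteq> G'" for c :: "'q \<times> (int \<Rightarrow> 'g option) \<times> int"
  have fwd: "ntm_step \<Delta>' (code c) (code c')" if step: "machine_step \<Delta> c c'" for c c'
  proof -
    obtain q t h q' b d where s: "c = (q, t, h)" "(q, t h, q', b, d) \<in> \<Delta>" "c' = (q', t(h := b), h + d)"
      using step unfolding machine_step_def by blast
    have "(eq q, (eg \<circ> t) h, eq q', eg b, d) \<in> \<Delta>'" using s(2) unfolding \<Delta>'_def by force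
    then show ?thesis unfolding ntm_step_def code_def s(1,3) by (auto simp: fun_upd_comp)
  qed
  have bwd: "\<exists>c'. machine_step \<Delta> c c' \<and> x = code c' \<and> ok c'"
    if step: "ntm_step \<Delta>' (code c) x" and "ok c" for c x
  proof -
    obtain q t h where c: "c = (q, t, h)" by (cases c)
    obtain e b' d where s: "(eq q, eg (t h), e, b', d) \<in> \<Delta>'" "x = (e, (eg \<circ> t)(h := b'), h + d)"
      using step unfolding ntm_step_def code_def c by auto
    then obtain q1 a1 q' b where r: "(q1, a1, q', b, d) \<in> \<Delta>" "eq q1 = eq q" "eg a1 = eg (t h)"
      "e = eq q'" "b' = eg b" unfolding \<Delta>'_def by auto
    have mem: "q1 \<in> Q" "a1 \<in> G'" "q' \<in> Q" "b \<in> G'" using r(1) \<Delta> unfolding G'_def by auto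
    have okc: "q \<in> Q" "t h \<in> G'" "range t \<subseteq> G'" using \<open>ok c\<close> unfolding ok_def c by auto
    have "q1 = q" using eq r(2) mem okc by (meson inj_onD)
    moreover have "a1 = t h" using eg r(3) mem okc by (meson inj_onD)
    ultimately have "machine_step \<Delta> c (q', t(h := b), h + d)"
      using r(1) unfolding machine_step_def c by blast
    moreover have "x = code (q', t(h := b), h + d)" unfolding code_def s(2) r by (simp add: fun_upd_comp)
    moreover have "ok (q', t(h := b), h + d)" unfolding ok_def using mem okc by auto
    ultimately show ?thesis by blast
  qed
  have fwds: "(machine_step \<Delta> ^^ k) c c' \<Longrightarrow> (ntm_step \<Delta>' ^^ k) (code c) (code c')" for k c c'
  proof (induction k arbitrary: c')
    case (Suc k)
    then obtain y where "(machine_step \<Delta> ^^ k) c y" "machine_step \<Delta> y c'" by auto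
    then show ?case using Suc.IH fwd relpowp_Suc_I by metis
  qed simp
  have bwds: "(ntm_step \<Delta>' ^^ k) (code c) x \<Longrightarrow> ok c \<Longrightarrow> \<exists>c'. (machine_step \<Delta> ^^ k) c c' \<and> x = code c' \<and> ok c'" for k c x
  proof (induction k arbitrary: x)
    case (Suc k)
    then obtain y where y: "(ntm_step \<Delta>' ^^ k) (code c) y" "ntm_step \<Delta>' y x" by auto
    then obtain c' where c': "(machine_step \<Delta> ^^ k) c c'" "y = code c'" "ok c'" using Suc by blast
    then obtain c'' where "machine_step \<Delta> c' c''" "x = code c''" "ok c''" using bwd y(2) by blast
    then show ?case using relpowp_Suc_I[OF c'(1)] by blast
  qed auto
  have init: "ntm_init (Suc \<circ> ef) (eq q0) w = code (q0, tape_of w, 0)" for w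
    unfolding ntm_init_def code_def tape_of_def eg_def by (auto simp: fun_eq_iff)
  have ok_init: "ok (q0, tape_of w, 0)" if "w \<in> lists \<Sigma>" for w
  proof -
    have "w ! nat i \<in> G" if "0 \<le> i" "i < int (length w)" for i
      using that \<open>w \<in> lists \<Sigma>\<close> sub(3) nth_mem[of "nat i" w] by auto
    then show ?thesis using sub(1) unfolding ok_def G'_def tape_of_def by auto
  qed
  have accepts: "w \<in> L \<longleftrightarrow> ntm_accepts_within \<Delta>' (eq q0) (eq ` F) (Suc \<circ> ef) w (a * (length w + 1) ^ b)"
    if w: "w \<in> lists \<Sigma>" for w
  proof
    assume "w \<in> L"
    then obtain k c where k: "k \<le> a * (length w + 1) ^ b"
      "(machine_step \<Delta> ^^ k) (q0, tape_of w, 0) c" "fst c \<in> F" using complete w by blast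
    have "fst (code c) \<in> eq ` F" using k(3) unfolding code_def by (cases c) auto
    then show "ntm_accepts_within \<Delta>' (eq q0) (eq ` F) (Suc \<circ> ef) w (a * (length w + 1) ^ b)"
      unfolding ntm_accepts_within_def init using k(1) fwds[OF k(2)] by blast
  next
    assume "ntm_accepts_within \<Delta>' (eq q0) (eq ` F) (Suc \<circ> ef) w (a * (length w + 1) ^ b)"
    then obtain k x where k: "(ntm_step \<Delta>' ^^ k) (code (q0, tape_of w, 0)) x" "fst x \<in> eq ` F"
      unfolding ntm_accepts_within_def init by blast
    then obtain c where c: "(machine_step \<Delta> ^^ k) (q0, tape_of w, 0) c" "x = code c" "ok c"
      using bwds ok_init[OF w] by blast
    have "eq (fst c) \<in> eq ` F" using k(2) c(2) unfolding code_def by (cases c) auto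
    then have "fst c \<in> F" using eq c(3) sub(2) unfolding ok_def inj_on_def by blast
    then show "w \<in> L" using sound w c(1) by blast
  qed
  have "\<Delta>' \<subseteq> eq ` Q \<times> eg ` G' \<times> eq ` Q \<times> eg ` G' \<times> {-1, 0, 1}"
    using \<Delta> unfolding \<Delta>'_def G'_def by fastforce
  moreover have "finite (eq ` Q)" "finite (eg ` G')" "0 \<in> eg ` G'" "eq q0 \<in> eq ` Q" "eq ` F \<subseteq> eq ` Q"
    using fin sub unfolding G'_def eg_def by (auto simp: image_iff)
  moreover have "inj_on (Suc \<circ> ef) \<Sigma>" using ef sub(3) unfolding inj_on_def by auto
  moreover have "(Suc \<circ> ef) ` \<Sigma> \<subseteq> eg ` G' - {0}"
    using sub(3) unfolding G'_def eg_def by (force simp: image_iff)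
  ultimately have "\<exists>\<Gamma> \<Delta> q0 F enc c k. finite (eq ` Q) \<and> finite \<Gamma> \<and> 0 \<in> \<Gamma> \<and> q0 \<in> eq ` Q \<and> F \<subseteq> eq ` Q \<and>
      \<Delta> \<subseteq> eq ` Q \<times> \<Gamma> \<times> eq ` Q \<times> \<Gamma> \<times> {-1, 0, 1} \<and> inj_on enc \<Sigma> \<and> enc ` \<Sigma> \<subseteq> \<Gamma> - {0} \<and>
      (\<forall>w\<in>lists \<Sigma>. (w \<in> L) = ntm_accepts_within \<Delta> q0 F enc w (c * (length w + 1) ^ k))"
    by (intro exI[of _ "eg ` G'"] exI[of _ \<Delta>'] exI[of _ "eq q0"] exI[of _ "eq ` F"] exI[of _ "Suc \<circ> ef"]
        exI[of _ a] exI[of _ b] conjI ballI accepts)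
  moreover have "finite \<Sigma>" using fin(2) sub(3) by (rule finite_subset[rotated])
  ultimately show ?thesis unfolding in_NP_def by (intro conjI) (assumption, rule exI)
qed

lemma tape_of_read: "tape_of (P @ x # R) (int (length P)) = Some x"
  unfolding tape_of_def by simp

lemma tape_of_write: "(tape_of (P @ x # R))(int (length P) := Some y) = tape_of (P @ y # R)"
  unfolding tape_of_def by (auto simp: fun_eq_iff nth_append nth_Cons')

lemma tape_of_end: "tape_of T (int (length T)) = None"
  unfolding tape_of_def by simp

lemma tape_of_extend: "(tape_of T)(int (length T) := Some y) = tape_of (T @ [y])"
  unfolding tape_of_def by (auto simp: fun_eq_iff nth_append)

lemma tape_of_neg: "tape_of T (-1) = None"
  unfolding tape_of_def by simp

lemma tape_of_SomeD:
  assumes "tape_of (P @ R) (int (length P)) = Some x"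
  obtains R' where "R = x # R'"
  using assms that unfolding tape_of_def by (cases R) (auto split: if_splits)

lemma tape_of_NoneD: "tape_of (P @ R) (int (length P)) = None \<Longrightarrow> R = []"
  unfolding tape_of_def by (cases R) (auto split: if_splits)

section \<open>A machine for the word problem\<close>

text \<open>
  The tape holds \<open>u # v 1 \<dots> 1\<close>, where the separator is \<^const>\<open>None\<close> and the letter \<open>1\<close> serves as padding
  inside the word; the blank marks both ends. After appending a guessed amount of padding
  (\<open>Pad\<close>), the machine returns to the left end (\<open>Rewind\<close>) and chooses among three kinds of sweep:
  rewriting \<open>v\<close> (\<open>Seek\<close>, then \<open>Carry\<close>), deleting a common first letter of both sides (\<open>Pick\<close>, \<open>Bring\<close>,
  \<open>Match\<close>), or checking that nothing but padding is left (\<open>Check\<close>, \<open>Check_blank\<close>).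
\<close>

datatype 'm state = Pad | Rewind | Seek | Carry 'm | Pick | Bring 'm | Match 'm
  | Check | Check_blank | Accept

locale word_machine =
  fixes C S :: "'m::monoid_mult set"
  assumes finite_C: "finite C" and finite_S: "finite S" and one_C: "1 \<in> C" and one_S: "1 \<in> S"
begin

text \<open>These are the transitions that read a letter and move right. Deletion writes 1 instead
  of shifting the tape, so the length is preserved.\<close>

inductive forward :: "'m state \<Rightarrow> 'm option \<Rightarrow> 'm state \<Rightarrow> 'm option \<Rightarrow> bool" where
  pad: "x \<in> insert None (Some ` C) \<Longrightarrow> forward Pad x Pad x"
| seek: "a \<in> C \<Longrightarrow> forward Seek (Some a) Seek (Some a)"
| seek_sep: "forward Seek None (Carry 1) None"
| carry: "a \<in> C \<Longrightarrow> b \<in> C \<Longrightarrow> s \<in> S \<Longrightarrow> t \<in> S \<Longrightarrow> s * a = b * t \<Longrightarrow>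
    forward (Carry s) (Some a) (Carry t) (Some b)"
| pick_one: "forward Pick (Some 1) Pick (Some 1)"
| pick: "a \<in> C \<Longrightarrow> forward Pick (Some a) (Bring a) (Some 1)"
| bring: "a \<in> C \<Longrightarrow> b \<in> C \<Longrightarrow> forward (Bring a) (Some b) (Bring a) (Some b)"
| bring_sep: "a \<in> C \<Longrightarrow> forward (Bring a) None (Match a) None"
| match_one: "a \<in> C \<Longrightarrow> forward (Match a) (Some 1) (Match a) (Some 1)"
| match: "a \<in> C \<Longrightarrow> forward (Match a) (Some a) (Carry 1) (Some 1)"
| check: "forward Check (Some 1) Check (Some 1)"
| check_sep: "forward Check None Check_blank None"
| check_blank: "forward Check_blank (Some 1) Check_blank (Some 1)"

text \<open>A sweep can turn back at the right end only from \<open>Carry 1\<close>, that is, with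
  nothing left to insert. Rewinding ends at the blank at position -1.\<close>

definition transitions :: "('m state \<times> 'm option option \<times> 'm state \<times> 'm option option \<times> int) set" where
  "transitions =
     {(q, Some x, q', Some y, 1) | q x q' y. forward q x q' y} \<union>
     {(Rewind, Some x, Rewind, Some x, -1) | x. x \<in> insert None (Some ` C)} \<union>
     {(Rewind, None, q, None, 1) | q. q \<in> {Seek, Pick, Check}} \<union>
     {(Pad, None, Pad, Some (Some 1), 1), (Pad, None, Rewind, None, -1),
      (Carry 1, None, Rewind, None, -1), (Check_blank, None, Accept, None, 0)}"

definition states :: "'m state set" where
  "states = {Pad, Rewind, Seek, Pick, Check, Check_blank, Accept} \<union> Carry ` S \<union> Bring ` C \<union> Match ` C"

abbreviation "step \<equiv> machine_step transitions"

lemma forward_closed: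
  assumes "forward q x q' y"
  shows "q \<in> states" "q' \<in> states" "x \<in> insert None (Some ` C)" "y \<in> insert None (Some ` C)"
    "q \<noteq> Rewind" "q' \<noteq> Rewind"
proof -
  have "q \<in> states \<and> q' \<in> states \<and> x \<in> insert None (Some ` C) \<and> y \<in> insert None (Some ` C) \<and>
      q \<noteq> Rewind \<and> q' \<noteq> Rewind"
    using assms by (cases rule: forward.cases) (simp_all add: states_def one_C one_S)
  then show "q \<in> states" "q' \<in> states" "x \<in> insert None (Some ` C)" "y \<in> insert None (Some ` C)"
    "q \<noteq> Rewind" "q' \<noteq> Rewind" by blast+
qed

lemma transitions_closed:
  "transitions \<subseteq> states \<times> insert None (Some ` insert None (Some ` C)) \<times> states \<times>
     insert None (Some ` insert None (Some ` C)) \<times> {-1, 0, 1}"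
proof (rule subsetI)
  fix z assume z: "z \<in> transitions"
  have st: "{Pad, Rewind, Seek, Pick, Check, Check_blank, Accept, Carry 1} \<subseteq> states"
    unfolding states_def using one_S by blast
  consider (fwd) q x q' y where "z = (q, Some x, q', Some y, 1)" "forward q x q' y"
    | (rew) x where "z = (Rewind, Some x, Rewind, Some x, -1)" "x \<in> insert None (Some ` C)"
    | (start) q where "z = (Rewind, None, q, None, 1)" "q \<in> {Seek, Pick, Check}"
    | (blank) "z \<in> {(Pad, None, Pad, Some (Some 1), 1), (Pad, None, Rewind, None, -1),
      (Carry 1, None, Rewind, None, -1), (Check_blank, None, Accept, None, 0)}"
    using z unfolding transitions_def by blast
  then show "z \<in> states \<times> insert None (Some ` insert None (Some ` C)) \<times> states \<times>
     insert None (Some ` insert None (Some ` C)) \<times> {-1, 0, 1}"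
  proof cases
    case fwd
    show ?thesis unfolding fwd(1) using forward_closed(1-4)[OF fwd(2)] by blast
  next
    case rew
    then show ?thesis using st by blast
  next
    case start
    then show ?thesis using st by blast
  next
    case blank
    then show ?thesis using st one_C by auto
  qed
qed

section \<open>Soundness: pulling acceptance back to the input\<close>

definition balanced :: "'m option list \<Rightarrow> bool" where
  "balanced T \<longleftrightarrow> (\<exists>X Y. T = map Some X @ None # map Some Y \<and> prod_list X = prod_list Y)"

text \<open>
  A condition on the tape contents \<open>P\<close> left of the head and \<open>R\<close> from the head on which is pulled back
  along every transition: it holds on acceptance, and in the initial configuration it says that the
  input is balanced.
\<close>

fun promise :: "'m state \<Rightarrow> 'm option list \<Rightarrow> 'm option list \<Rightarrow> bool" where
  "promise Pad P R = balanced (P @ R)"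
| "promise Rewind P R = balanced (P @ R)"
| "promise Seek P R = balanced (P @ R)"
| "promise (Carry s) P R = (\<exists>X Z Y. P = map Some X @ None # map Some Z \<and> R = map Some Y \<and>
     prod_list X = prod_list Z * s * prod_list Y)"
| "promise Pick P R = (\<exists>X X' Y a x. P = map Some X \<and> R = map Some X' @ None # map Some Y \<and>
     prod_list X' = a * x \<and> a * prod_list X * x = prod_list Y)"
| "promise (Bring a) P R = (\<exists>X X' Y. P = map Some X \<and> R = map Some X' @ None # map Some Y \<and>
     a * prod_list X * prod_list X' = prod_list Y)"
| "promise (Match a) P R = (\<exists>X Z Y x. P = map Some X @ None # map Some Z \<and> R = map Some Y \<and>
     prod_list Y = a * x \<and> prod_list X = prod_list Z * x)"
| "promise Check P R = (\<exists>X Y. R = map Some X @ None # map Some Y \<and> set X \<subseteq> {1} \<and> set Y \<subseteq> {1})"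
| "promise Check_blank P R = (\<exists>Y. R = map Some Y \<and> set Y \<subseteq> {1})"
| "promise Accept P R = True"

lemma snoc_Some_split:
  assumes "P @ [Some b] = map Some X @ None # map Some Z"
  obtains Z' where "Z = Z' @ [b]" "P = map Some X @ None # map Some Z'"
proof (cases Z rule: rev_cases)
  case Nil
  then show thesis using assms by simp
next
  case (snoc Z' c)
  then show thesis using assms that[of Z'] by simp
qed

lemma snoc_None_split:
  assumes "P @ [None] = map Some X @ None # map Some Z"
  shows "Z = []" "P = map Some X"
proof -
  have "Z = [] \<and> P = map Some X" using assms by (cases Z rule: rev_cases) simp_all
  then show "Z = []" "P = map Some X" by simp_all
qed

lemma snoc_map_split:
  assumes "P @ [Some b] = map Some X"
  obtains X' where "X = X' @ [b]" "P = map Some X'"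
proof (cases X rule: rev_cases)
  case Nil
  then show thesis using assms by simp
next
  case (snoc X' c)
  then show thesis using assms that[of X'] by simp
qed

lemma prod_list_ones: "set X \<subseteq> {1} \<Longrightarrow> prod_list X = 1"
  by (induction X) auto

text \<open>For \<open>carry\<close> the equation \<open>s * a = b * t\<close> makes the product
  unchanged. For the deleting sweep, a matched pair gives \<open>prod_list X = x\<close> and
  \<open>prod_list Y = a * x\<close>, and restoring the picked \<open>a\<close> turns the left
  product into \<open>a * x\<close> as well; the cells passed over before either occurrence of
  \<open>a\<close> hold 1.\<close>

lemma forward_promise:
  assumes "forward q x q' y" "promise q' (P @ [y]) R"
  shows "promise q P (x # R)"
  using assms
proof (cases rule: forward.cases)
  case (seek_sep)
  then obtain X Z Y where h: "P @ [None] = map Some X @ None # map Some Z" "R = map Some Y"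
    "prod_list X = prod_list Z * 1 * prod_list Y" using assms(2) by auto
  show ?thesis using snoc_None_split[OF h(1)] h seek_sep by (auto simp: balanced_def)
next
  case (carry a b s t)
  then obtain X Z Y where h: "P @ [Some b] = map Some X @ None # map Some Z" "R = map Some Y"
    "prod_list X = prod_list Z * t * prod_list Y" using assms(2) by auto
  obtain Z' where Z: "Z = Z' @ [b]" "P = map Some X @ None # map Some Z'" using snoc_Some_split[OF h(1)] .
  have "prod_list X = prod_list Z' * s * prod_list (a # Y)"
    using h(3) Z(1) carry by (simp add: mult.assoc) (metis mult.assoc)
  then have "promise (Carry s) P (Some a # R)" unfolding promise.simps
    by (intro exI[of _ X] exI[of _ Z'] exI[of _ "a # Y"]) (simp add: Z(2) h(2))
  then show ?thesis using carry by simp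
next
  case (pick_one)
  then obtain X X' Y a z where h: "P @ [Some 1] = map Some X" "R = map Some X' @ None # map Some Y"
     "prod_list X' = a * z" "a * prod_list X * z = prod_list Y" using assms(2) by auto
  obtain X0 where X: "X = X0 @ [1]" "P = map Some X0" using snoc_map_split[OF h(1)] .
  have "promise Pick P (Some 1 # R)" unfolding promise.simps
    by (intro exI[of _ X0] exI[of _ "1 # X'"] exI[of _ Y] exI[of _ a] exI[of _ z]) (use X h in simp)
  then show ?thesis using pick_one by simp
next
  case (pick a)
  then obtain X X' Y where h: "P @ [Some 1] = map Some X" "R = map Some X' @ None # map Some Y"
     "a * prod_list X * prod_list X' = prod_list Y" using assms(2) by auto
  obtain X0 where X: "X = X0 @ [1]" "P = map Some X0" using snoc_map_split[OF h(1)] .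
  have "promise Pick P (Some a # R)" unfolding promise.simps
    by (intro exI[of _ X0] exI[of _ "a # X'"] exI[of _ Y] exI[of _ a] exI[of _ "prod_list X'"]) (use X h in simp)
  then show ?thesis using pick by simp
next
  case (bring a b)
  then obtain X X' Y where h: "P @ [Some b] = map Some X" "R = map Some X' @ None # map Some Y"
     "a * prod_list X * prod_list X' = prod_list Y" using assms(2) by auto
  obtain X0 where X: "X = X0 @ [b]" "P = map Some X0" using snoc_map_split[OF h(1)] .
  have "promise (Bring a) P (Some b # R)" unfolding promise.simps
    by (intro exI[of _ X0] exI[of _ "b # X'"] exI[of _ Y]) (use X h in \<open>simp add: mult.assoc\<close>)
  then show ?thesis using bring by simp
next
  case (bring_sep a)
  then obtain X Z Y z where h: "P @ [None] = map Some X @ None # map Some Z" "R = map Some Y"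
    "prod_list Y = a * z" "prod_list X = prod_list Z * z" using assms(2) by auto
  have "promise (Bring a) P (None # R)" unfolding promise.simps
    by (intro exI[of _ X] exI[of _ "[]"] exI[of _ Y]) (use snoc_None_split[OF h(1)] h in simp)
  then show ?thesis using bring_sep by simp
next
  case (match_one a)
  then obtain X Z Y z where h: "P @ [Some 1] = map Some X @ None # map Some Z" "R = map Some Y"
    "prod_list Y = a * z" "prod_list X = prod_list Z * z" using assms(2) by auto
  obtain Z' where Z: "Z = Z' @ [1]" "P = map Some X @ None # map Some Z'" using snoc_Some_split[OF h(1)] .
  have "promise (Match a) P (Some 1 # R)" unfolding promise.simps
    by (intro exI[of _ X] exI[of _ Z'] exI[of _ "1 # Y"] exI[of _ z]) (use Z h in simp)
  then show ?thesis using match_one by simp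
next
  case (match a)
  then obtain X Z Y where h: "P @ [Some 1] = map Some X @ None # map Some Z" "R = map Some Y"
    "prod_list X = prod_list Z * 1 * prod_list Y" using assms(2) by auto
  obtain Z' where Z: "Z = Z' @ [1]" "P = map Some X @ None # map Some Z'" using snoc_Some_split[OF h(1)] .
  have "promise (Match a) P (Some a # R)" unfolding promise.simps
    by (intro exI[of _ X] exI[of _ Z'] exI[of _ "a # Y"] exI[of _ "prod_list Y"]) (use Z h in simp)
  then show ?thesis using match by simp
next
  case check
  then obtain X Y where "R = map Some X @ None # map Some Y" "set X \<subseteq> {1}" "set Y \<subseteq> {1}"
    using assms(2) by auto
  then have "promise Check P (Some 1 # R)" unfolding promise.simps
    by (intro exI[of _ "1 # X"] exI[of _ Y]) simp
  then show ?thesis using check by simp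
next
  case check_sep
  then obtain Y where "R = map Some Y" "set Y \<subseteq> {1}" using assms(2) by auto
  then have "promise Check P (None # R)" unfolding promise.simps
    by (intro exI[of _ "[]"] exI[of _ Y]) simp
  then show ?thesis using check_sep by simp
next
  case check_blank
  then obtain Y where "R = map Some Y" "set Y \<subseteq> {1}" using assms(2) by auto
  then have "promise Check_blank P (Some 1 # R)" unfolding promise.simps
    by (intro exI[of _ "1 # Y"]) simp
  then show ?thesis using check_blank by simp
qed simp_all

lemma promise_start:
  assumes "q \<in> {Seek, Pick, Check}" "promise q [] T"
  shows "balanced T"
proof -
  have "\<exists>X Y. T = map Some X @ None # map Some Y \<and> prod_list X = prod_list Y" if "promise Check [] T"
    using that prod_list_ones unfolding promise.simps by metis
  moreover have "\<exists>X Y. T = map Some X @ None # map Some Y \<and> prod_list X = prod_list Y" if "promise Pick [] T"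
    using that unfolding promise.simps by (metis Nil_is_map_conv mult.right_neutral prod_list.Nil)
  ultimately show ?thesis using assms unfolding balanced_def by (auto simp del: promise.simps(5,8) simp: balanced_def)
qed

lemma balanced_snoc_one:
  assumes "balanced (T @ [Some 1])"
  shows "balanced T"
proof -
  obtain X Y where h: "T @ [Some 1] = map Some X @ None # map Some Y" "prod_list X = prod_list Y"
    using assms unfolding balanced_def by blast
  obtain Y' where Y: "Y = Y' @ [1]" "T = map Some X @ None # map Some Y'" using snoc_Some_split[OF h(1)] .
  then show ?thesis unfolding balanced_def using h(2) by auto
qed

lemma promise_Carry_end:
  assumes "balanced T"
  shows "promise (Carry 1) T []"
proof -
  obtain X Y where "T = map Some X @ None # map Some Y" "prod_list X = prod_list Y"
    using assms unfolding balanced_def by blast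
  then show ?thesis unfolding promise.simps
    by (intro exI[of _ X] exI[of _ Y] exI[of _ "[]"]) simp
qed

text \<open>\<open>Rewind\<close> is treated apart because its head may stand at -1, where the tape
  has no division into \<open>P\<close> and \<open>R\<close>.\<close>

definition invariant :: "'m option list \<Rightarrow> 'm state \<times> (int \<Rightarrow> 'm option option) \<times> int \<Rightarrow> bool" where
  "invariant w c \<longleftrightarrow> (case c of (q, t, h) \<Rightarrow>
     (if q = Rewind then \<exists>T. t = tape_of T \<and> -1 \<le> h \<and> h < int (length T) \<and> (balanced T \<longrightarrow> balanced w)
      else \<exists>P R. t = tape_of (P @ R) \<and> h = int (length P) \<and> (promise q P R \<longrightarrow> balanced w)))"

lemma invariant_Rewind: "invariant w (Rewind, t, h) \<longleftrightarrow>
    (\<exists>T. t = tape_of T \<and> -1 \<le> h \<and> h < int (length T) \<and> (balanced T \<longrightarrow> balanced w))"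
  unfolding invariant_def by simp

lemma invariant_other: "q \<noteq> Rewind \<Longrightarrow> invariant w (q, t, h) \<longleftrightarrow>
    (\<exists>P R. t = tape_of (P @ R) \<and> h = int (length P) \<and> (promise q P R \<longrightarrow> balanced w))"
  unfolding invariant_def by simp

lemma invariantI: "q \<noteq> Rewind \<Longrightarrow> t = tape_of (P @ R) \<Longrightarrow> h = int (length P) \<Longrightarrow>
    (promise q P R \<Longrightarrow> balanced w) \<Longrightarrow> invariant w (q, t, h)"
  using invariant_other[of q w t h] by blast

lemma invariant_Rewind_left: "(balanced T \<Longrightarrow> balanced w) \<Longrightarrow> invariant w (Rewind, tape_of T, int (length T) + -1)"
  unfolding invariant_Rewind by (intro exI[of _ T]) simp

lemma invariant_step:
  assumes "invariant w c" "step c c'"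
  shows "invariant w c'"
proof -
  obtain q t h q' b d where s: "c = (q, t, h)" "(q, t h, q', b, d) \<in> transitions"
    "c' = (q', t(h := b), h + d)" using assms(2) unfolding machine_step_def by blast
  have inv: "invariant w (q, t, h)" using assms(1) s(1) by simp
  consider (fwd) x y where "forward q x q' y" "t h = Some x" "b = Some y" "d = 1"
    | (rew) x where "q = Rewind" "t h = Some x" "q' = Rewind" "b = Some x" "d = -1"
    | (start) "q = Rewind" "t h = None" "q' \<in> {Seek, Pick, Check}" "b = None" "d = 1"
    | (blank) "t h = None" "q = Pad \<and> q' = Pad \<and> b = Some (Some 1) \<and> d = 1 \<or>
        q = Pad \<and> q' = Rewind \<and> b = None \<and> d = -1 \<or>
        q = Carry 1 \<and> q' = Rewind \<and> b = None \<and> d = -1 \<or>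
        q = Check_blank \<and> q' = Accept \<and> b = None \<and> d = 0"
    using s(2) unfolding transitions_def by auto
  then show ?thesis
  proof cases
    case fwd
    obtain P R where P: "t = tape_of (P @ R)" "h = int (length P)" "promise q P R \<longrightarrow> balanced w"
      using inv unfolding invariant_other[OF forward_closed(5)[OF fwd(1)]] by blast
    then obtain R' where R: "R = x # R'" using fwd(2) tape_of_SomeD by metis
    show ?thesis unfolding s(3)
    proof (rule invariantI[OF forward_closed(6)[OF fwd(1)]])
      show "t(h := b) = tape_of ((P @ [y]) @ R')" using tape_of_write[of P x R' y] P R fwd(3) by simp
      show "h + d = int (length (P @ [y]))" using P fwd by simp
      show "balanced w" if "promise q' (P @ [y]) R'" using P(3) R forward_promise[OF fwd(1) that] by blast
    qed
  next
    case rew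
    then obtain T where T: "t = tape_of T" "-1 \<le> h" "h < int (length T)" "balanced T \<longrightarrow> balanced w"
      using inv unfolding rew(1) invariant_Rewind by blast
    have "0 \<le> h" using rew(2) unfolding T(1) tape_of_def by (metis option.distinct(1))
    moreover have "t(h := b) = t" using rew by (simp add: fun_upd_idem)
    ultimately show ?thesis unfolding s(3) rew(3) invariant_Rewind using T rew(5) by (intro exI[of _ T]) simp
  next
    case start
    then obtain T where T: "t = tape_of T" "-1 \<le> h" "h < int (length T)" "balanced T \<longrightarrow> balanced w"
      using inv unfolding start(1) invariant_Rewind by blast
    \<comment> \<open>The head is left of the end of \<open>T\<close> and reads a blank, so it has
      run off the left end.\<close>
    have "h = -1"
    proof (rule ccontr)
      assume "h \<noteq> -1"
      then have "0 \<le> h" using T(2) by simp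
      then show False using start(2) T(3) unfolding T(1) tape_of_def by simp
    qed
    show ?thesis unfolding s(3)
    proof (rule invariantI[of _ _ "[]" T])
      show "q' \<noteq> Rewind" using start(3) by auto
      show "t(h := b) = tape_of ([] @ T)" using start T(1) by (simp add: fun_upd_idem)
      show "h + d = int (length [])" using \<open>h = -1\<close> start by simp
      show "balanced w" if "promise q' [] T" using promise_start[OF start(3) that] T(4) by blast
    qed
  next
    case blank
    then have "q \<noteq> Rewind" by auto
    then obtain P R where P: "t = tape_of (P @ R)" "h = int (length P)" "promise q P R \<longrightarrow> balanced w"
      using inv unfolding invariant_other[OF \<open>q \<noteq> Rewind\<close>] by blast
    have R: "R = []" using blank(1) P(1,2) tape_of_NoneD by metis
    have t: "t = tape_of P" using P(1) R by simp
    have upd: "t(h := None) = tape_of P" using blank(1) t by (simp add: fun_upd_idem)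
    from blank(2) show ?thesis
    proof (elim disjE conjE)
      assume a: "q = Pad" "q' = Pad" "b = Some (Some 1)" "d = 1"
      have "(tape_of P)(h := b) = tape_of ((P @ [Some 1]) @ [])"
        using tape_of_extend[of P "Some 1"] P(2) a(3) by simp
      moreover have "balanced w" if "promise Pad (P @ [Some 1]) []" using P(3) R a that balanced_snoc_one by simp
      moreover have "h + d = int (length (P @ [Some 1]))" using P(2) a(4) by simp
      ultimately show ?thesis unfolding s(3) t a(2) by (intro invariantI[of _ _ "P @ [Some 1]" "[]"]) simp_all
    next
      assume a: "q = Pad" "q' = Rewind" "b = None" "d = -1"
      have "c' = (Rewind, tape_of P, int (length P) + -1)" using s(3) a upd P(2) by simp
      moreover have "balanced w" if "balanced P" using P(3) R a that by simp
      ultimately show ?thesis using invariant_Rewind_left by blast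
    next
      assume a: "q = Carry 1" "q' = Rewind" "b = None" "d = -1"
      have "c' = (Rewind, tape_of P, int (length P) + -1)" using s(3) a upd P(2) by simp
      moreover have "balanced w" if "balanced P" using P(3) R a promise_Carry_end[OF that] by blast
      ultimately show ?thesis using invariant_Rewind_left by blast
    next
      assume a: "q = Check_blank" "q' = Accept" "b = None" "d = 0"
      have "c' = (Accept, tape_of (P @ []), int (length P))" using s(3) a upd P(2) by simp
      moreover have "balanced w" using P(3) R a by simp
      ultimately show ?thesis using invariantI[of Accept _ P "[]"] by simp
    qed
  qed
qed

text \<open>In \<open>Accept\<close> the promise is \<open>True\<close>, so the invariant yields the
  claim outright.\<close>

lemma accepting_sound:
  assumes "(step ^^ k) (Pad, tape_of w, 0) c" "fst c = Accept"
  shows "balanced w"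
proof -
  have "invariant w c" using assms(1)
  proof (induction k arbitrary: c)
    case 0
    then show ?case by (auto intro: invariantI[of _ _ "[]" w])
  next
    case (Suc k)
    then obtain c0 where "(step ^^ k) (Pad, tape_of w, 0) c0" "step c0 c" by auto
    then show ?case using Suc.IH invariant_step by blast
  qed
  moreover obtain t h where "c = (Accept, t, h)" using assms(2) by (cases c) auto
  ultimately show ?thesis by (auto simp: invariant_other)
qed

section \<open>Sweeps and their running time\<close>

inductive run :: "'m state \<Rightarrow> 'm option list \<Rightarrow> 'm state \<Rightarrow> 'm option list \<Rightarrow> bool" where
  Nil: "run q [] q []"
| Cons: "forward q x q1 y \<Longrightarrow> run q1 X q' Y \<Longrightarrow> run q (x # X) q' (y # Y)"

lemma run_append: "run q X q1 Y \<Longrightarrow> run q1 X' q' Y' \<Longrightarrow> run q (X @ X') q' (Y @ Y')"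
  by (induction rule: run.induct) (auto intro: run.intros)

lemma run_length: "run q X q' Y \<Longrightarrow> length Y = length X"
  by (induction rule: run.induct) auto

lemma run_loop: "(\<And>x. x \<in> set X \<Longrightarrow> forward q x q x) \<Longrightarrow> run q X q X"
  by (induction X) (auto intro: run.intros)

lemma step_forward:
  "forward q x q' y \<Longrightarrow>
    step (q, tape_of (P @ x # R), int (length P)) (q', tape_of (P @ y # R), int (length P) + 1)"
  unfolding machine_step_def
  by (intro exI[of _ q] exI[of _ "tape_of (P @ x # R)"] exI[of _ "int (length P)"] exI[of _ q']
      exI[of _ "Some y"] exI[of _ "1::int"] conjI)
    (simp_all add: tape_of_read tape_of_write transitions_def)

lemma step_blank:
  "t h = None \<Longrightarrow> (q, None, q', None, d) \<in> transitions \<Longrightarrow> step (q, t, h) (q', t, h + d)"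
  unfolding machine_step_def
  by (intro exI[of _ q] exI[of _ t] exI[of _ h] exI[of _ q'] exI[of _ None] exI[of _ d] conjI)
    (simp_all add: fun_upd_idem)

lemma run_steps:
  "run q X q' Y \<Longrightarrow> (step ^^ length X) (q, tape_of (P @ X @ R), int (length P))
     (q', tape_of (P @ Y @ R), int (length P + length X))"
proof (induction arbitrary: P rule: run.induct)
  case (Cons q x q1 y X q' Y)
  have "step (q, tape_of (P @ (x # X) @ R), int (length P)) (q1, tape_of ((P @ [y]) @ X @ R), int (length (P @ [y])))"
    using step_forward[OF Cons.hyps(1), of P "X @ R"] by (simp add: add.commute)
  from relpowp_Suc_I2[OF this Cons.IH] show ?case by (simp add: add.commute)
qed simp

lemma step_rewind:
  assumes "set T \<subseteq> insert None (Some ` C)" "k < length T"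
  shows "step (Rewind, tape_of T, int k) (Rewind, tape_of T, int k + -1)"
proof -
  have "T ! k \<in> insert None (Some ` C)" using assms nth_mem by blast
  then have "(Rewind, tape_of T (int k), Rewind, tape_of T (int k), -1) \<in> transitions"
    using assms(2) unfolding transitions_def tape_of_def by simp
  then show ?thesis unfolding machine_step_def
    by (intro exI[of _ Rewind] exI[of _ "tape_of T"] exI[of _ "int k"] exI[of _ Rewind]
        exI[of _ "tape_of T (int k)"] exI[of _ "-1::int"] conjI) simp_all
qed

lemma rewind_steps:
  assumes "set T \<subseteq> insert None (Some ` C)"
  shows "k \<le> length T \<Longrightarrow> (step ^^ k) (Rewind, tape_of T, int k + -1) (Rewind, tape_of T, -1)"
proof (induction k)
  case (Suc k)
  have "step (Rewind, tape_of T, int (Suc k) + -1) (Rewind, tape_of T, int k + -1)"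
    using step_rewind[OF assms, of k] Suc.prems by simp
  moreover have "(step ^^ k) (Rewind, tape_of T, int k + -1) (Rewind, tape_of T, -1)"
    using Suc by simp
  ultimately show ?case by (rule relpowp_Suc_I2)
qed simp

text \<open>The condition on letters is what lets the machine rewind over the new tape.\<close>

definition sweep :: "'m option list \<Rightarrow> 'm option list \<Rightarrow> bool" where
  "sweep T T' \<longleftrightarrow> (\<exists>q\<in>{Seek, Pick}. run q T (Carry 1) T') \<and> set T' \<subseteq> insert None (Some ` C)"

lemma sweep_length: "sweep T T' \<Longrightarrow> length T' = length T"
  unfolding sweep_def using run_length by blast

lemma start_step:
  "q \<in> {Seek, Pick, Check} \<Longrightarrow> step (Rewind, tape_of T, -1) (q, tape_of T, 0)"
  using step_blank[of "tape_of T" "-1" Rewind q 1] tape_of_neg[of T]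
  by (auto simp: transitions_def)

text \<open>One step leaves the left blank, \<open>length T\<close> steps cross the tape, one turns
  at the right blank, and \<open>length T\<close> steps lead back.\<close>

lemma sweep_steps:
  assumes "sweep T T'"
  shows "(step ^^ (2 * length T + 2)) (Rewind, tape_of T, -1) (Rewind, tape_of T', -1)"
proof -
  obtain q where q: "q \<in> {Seek, Pick}" "run q T (Carry 1) T'" "set T' \<subseteq> insert None (Some ` C)"
    using assms unfolding sweep_def by blast
  let ?n = "length T"
  have len: "length T' = ?n" using sweep_length[OF assms] .
  have "step (Rewind, tape_of T, -1) (q, tape_of T, 0)" using q(1) by (intro start_step) blast
  moreover have "(step ^^ ?n) (q, tape_of T, 0) (Carry 1, tape_of T', int ?n)"
    using run_steps[OF q(2), of "[]" "[]"] by simp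
  ultimately have "(step ^^ Suc ?n) (Rewind, tape_of T, -1) (Carry 1, tape_of T', int ?n)"
    by (rule relpowp_Suc_I2)
  moreover have "step (Carry 1, tape_of T', int ?n) (Rewind, tape_of T', int ?n + -1)"
    using tape_of_end[of T'] len by (intro step_blank) (simp_all add: transitions_def)
  ultimately have "(step ^^ Suc (Suc ?n)) (Rewind, tape_of T, -1) (Rewind, tape_of T', int ?n + -1)"
    by (rule relpowp_Suc_I)
  moreover have "(step ^^ ?n) (Rewind, tape_of T', int ?n + -1) (Rewind, tape_of T', -1)"
    using len by (intro rewind_steps[OF q(3)]) simp
  ultimately have "(step ^^ (Suc (Suc ?n) + ?n)) (Rewind, tape_of T, -1) (Rewind, tape_of T', -1)"
    by (rule relpowp_trans)
  moreover have "Suc (Suc ?n) + ?n = 2 * ?n + 2" by simp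
  ultimately show ?thesis by (simp only:)
qed

lemma sweeps_steps:
  "(sweep ^^ j) T T' \<Longrightarrow> length T' = length T \<and>
    (step ^^ (j * (2 * length T + 2))) (Rewind, tape_of T, -1) (Rewind, tape_of T', -1)"
proof (induction j arbitrary: T')
  case (Suc j)
  then obtain U where U: "(sweep ^^ j) T U" "sweep U T'" by auto
  note IH = Suc.IH[OF U(1)]
  have "(step ^^ (j * (2 * length T + 2) + (2 * length T + 2))) (Rewind, tape_of T, -1) (Rewind, tape_of T', -1)"
    using IH sweep_steps[OF U(2)] by (metis relpowp_trans)
  then show ?case using IH sweep_length[OF U(2)] by (simp only: mult_Suc add.commute)
qed simp

lemma pad_steps:
  assumes "set w \<subseteq> insert None (Some ` C)"
  shows "(step ^^ (length w + m)) (Pad, tape_of w, 0)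
    (Pad, tape_of (w @ replicate m (Some 1)), int (length w + m))"
proof (induction m)
  case 0
  have "run Pad w Pad w" using assms by (intro run_loop forward.pad) blast
  then show ?case using run_steps[of Pad w Pad w "[]" "[]"] by simp
next
  case (Suc m)
  let ?T = "w @ replicate m (Some 1)"
  have T: "length ?T = length w + m" by simp
  have "step (Pad, tape_of ?T, int (length ?T)) (Pad, tape_of (?T @ [Some 1]), int (length ?T) + 1)"
    unfolding machine_step_def
    by (intro exI[of _ Pad] exI[of _ "tape_of ?T"] exI[of _ "int (length ?T)"] exI[of _ Pad]
        exI[of _ "Some (Some 1)"] exI[of _ "1::int"] conjI)
      (simp_all only: tape_of_extend tape_of_end transitions_def, simp_all)
  then have "step (Pad, tape_of ?T, int (length w + m))
      (Pad, tape_of (w @ replicate (Suc m) (Some 1)), int (length w + Suc m))"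
    unfolding T by (simp add: replicate_append_same add.commute)
  from relpowp_Suc_I[OF Suc.IH this] show ?case by simp
qed

lemma init_steps:
  assumes "set w \<subseteq> insert None (Some ` C)"
  shows "(step ^^ (2 * (length w + m) + 1)) (Pad, tape_of w, 0)
    (Rewind, tape_of (w @ replicate m (Some 1)), -1)"
proof -
  let ?T = "w @ replicate m (Some 1)" and ?n = "length w + m"
  have T: "set ?T \<subseteq> insert None (Some ` C)" using assms one_C by auto
  have "step (Pad, tape_of ?T, int ?n) (Rewind, tape_of ?T, int ?n + -1)"
    using tape_of_end[of ?T] by (intro step_blank) (simp_all add: transitions_def)
  from relpowp_Suc_I[OF pad_steps[OF assms] this]
  have "(step ^^ Suc ?n) (Pad, tape_of w, 0) (Rewind, tape_of ?T, int ?n + -1)" .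
  moreover have "(step ^^ ?n) (Rewind, tape_of ?T, int ?n + -1) (Rewind, tape_of ?T, -1)"
    by (intro rewind_steps[OF T]) simp
  ultimately have "(step ^^ (Suc ?n + ?n)) (Pad, tape_of w, 0) (Rewind, tape_of ?T, -1)"
    by (rule relpowp_trans)
  moreover have "Suc ?n + ?n = 2 * ?n + 1" by simp
  ultimately show ?thesis by (simp only:)
qed

lemma check_steps:
  assumes "set X \<subseteq> {1}" "set Y \<subseteq> {1}" and T: "T = map Some X @ None # map Some Y"
  shows "(step ^^ (length T + 2)) (Rewind, tape_of T, -1) (Accept, tape_of T, int (length T))"
proof -
  have "run Check (map Some X) Check (map Some X)"
    using assms(1) by (intro run_loop) (auto intro: forward.intros)
  moreover have "run Check_blank (map Some Y) Check_blank (map Some Y)"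
    using assms(2) by (intro run_loop) (auto intro: forward.intros)
  ultimately have "run Check T Check_blank T"
    unfolding T by (rule run_append[OF _ run.Cons[OF forward.check_sep]])
  then have "(step ^^ length T) (Check, tape_of T, 0) (Check_blank, tape_of T, int (length T))"
    using run_steps[of Check T Check_blank T "[]" "[]"] by simp
  then have "(step ^^ Suc (length T)) (Rewind, tape_of T, -1) (Check_blank, tape_of T, int (length T))"
    using start_step[of Check T] relpowp_Suc_I2[of step "(Rewind, tape_of T, -1)"] by blast
  moreover have "step (Check_blank, tape_of T, int (length T)) (Accept, tape_of T, int (length T) + 0)"
    using tape_of_end[of T] by (intro step_blank) (simp_all add: transitions_def)
  ultimately have "(step ^^ Suc (Suc (length T))) (Rewind, tape_of T, -1) (Accept, tape_of T, int (length T) + 0)"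
    by (rule relpowp_Suc_I)
  then show ?thesis by simp
qed

end

section \<open>Words up to padding\<close>

abbreviation strip :: "'m::monoid_mult list \<Rightarrow> 'm list" where
  "strip \<equiv> filter (\<lambda>a. a \<noteq> 1)"

lemma prod_list_strip: "prod_list (strip w) = prod_list w"
  by (induction w) auto

lemma prod_list_replicate_one: "prod_list (replicate n (1::'m::monoid_mult)) = 1"
  by (induction n) auto

text \<open>Locates a factor of the stripped word in the padded word on the tape.\<close>

lemma filter_append_split:
  "filter P w = u @ v \<Longrightarrow> \<exists>w1 w2. w = w1 @ w2 \<and> filter P w1 = u \<and> filter P w2 = v"
proof (induction u arbitrary: w)
  case Nil
  then show ?case by (intro exI[of _ "[]"] exI[of _ w]) simp
next
  case (Cons a u)
  then obtain p r where "w = p @ a # r" "\<forall>x\<in>set p. \<not> P x" "P a" "filter P r = u @ v"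
    by (auto simp: filter_eq_Cons_iff)
  moreover obtain r1 r2 where "r = r1 @ r2" "filter P r1 = u" "filter P r2 = v"
    using Cons.IH calculation(4) by blast
  ultimately show ?case by (intro exI[of _ "p @ a # r1"] exI[of _ r2]) simp
qed

section \<open>Carrying out derivations by sweeps\<close>

locale rewriting_machine =
  fixes C :: "'m::monoid_mult set" and K :: nat
  assumes finite_letters: "finite C" and one_letter: "1 \<in> C"
begin

definition carried :: "'m set" where
  "carried = prod_list ` {l. set l \<subseteq> C \<and> length l \<le> K}"

lemma carriedI: "set l \<subseteq> C \<Longrightarrow> length l \<le> K \<Longrightarrow> prod_list l \<in> carried"
  unfolding carried_def by blast

sublocale word_machine C carried
proof
  show "finite carried" unfolding carried_def using finite_letters by (simp add: finite_lists_length_le)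
  show "1 \<in> carried" using carriedI[of "[]"] by simp
qed (rule finite_letters one_letter)+

text \<open>The machine multiplies the letters of \<open>L\<close> into the carried element and
  leaves 1 behind. Padding inside \<open>L\<close> costs nothing, so only the stripped length must
  stay within \<open>K\<close>.\<close>

lemma run_absorb:
  "set l \<subseteq> C \<Longrightarrow> set L \<subseteq> C \<Longrightarrow> length l + length (strip L) \<le> K \<Longrightarrow>
    run (Carry (prod_list l)) (map Some L) (Carry (prod_list l * prod_list L)) (map Some (replicate (length L) 1))"
proof (induction L arbitrary: l)
  case Nil
  then show ?case by (simp add: run.Nil)
next
  case (Cons a L)
  show ?case
  proof (cases "a = 1")
    case True
    have "forward (Carry (prod_list l)) (Some a) (Carry (prod_list l)) (Some 1)"
      using Cons.prems one_letter True by (intro forward.carry carriedI) auto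
    moreover have "run (Carry (prod_list l)) (map Some L) (Carry (prod_list l * prod_list L)) (map Some (replicate (length L) 1))"
      using Cons.prems True by (intro Cons.IH) auto
    ultimately show ?thesis using True by (auto intro: run.Cons)
  next
    case False
    have "forward (Carry (prod_list l)) (Some a) (Carry (prod_list (l @ [a]))) (Some 1)"
      using Cons.prems one_letter False by (intro forward.carry carriedI) auto
    moreover have "run (Carry (prod_list (l @ [a]))) (map Some L) (Carry (prod_list (l @ [a]) * prod_list L))
        (map Some (replicate (length L) 1))"
      using Cons.prems False by (intro Cons.IH) auto
    ultimately show ?thesis by (auto intro: run.Cons simp: mult.assoc)
  qed
qed

text \<open>The carried element acts as a queue holding the word \<open>r\<close>, which delays the tape by \<open>length r\<close> cells.\<close>

lemma run_queue:
  "set r \<subseteq> C \<Longrightarrow> set Z \<subseteq> C \<Longrightarrow> length r \<le> K \<Longrightarrow>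
    run (Carry (prod_list r)) (map Some Z) (Carry (prod_list (drop (length Z) (r @ Z))))
      (map Some (take (length Z) (r @ Z)))"
proof (induction Z arbitrary: r)
  case Nil
  then show ?case by (simp add: run.Nil)
next
  case (Cons z Z)
  show ?case
  proof (cases r)
    case Nil
    have "forward (Carry (prod_list [])) (Some z) (Carry (prod_list [])) (Some z)"
      using Cons.prems by (intro forward.carry carriedI) auto
    then show ?thesis using run.Cons Cons.IH[of "[]"] Cons.prems Nil by fastforce
  next
    case (Cons b r')
    have "forward (Carry (prod_list r)) (Some z) (Carry (prod_list (r' @ [z]))) (Some b)"
      using Cons Cons.prems by (intro forward.carry carriedI) (auto simp: mult.assoc)
    moreover have "run (Carry (prod_list (r' @ [z]))) (map Some Z) (Carry (prod_list (drop (length Z) ((r' @ [z]) @ Z))))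
        (map Some (take (length Z) ((r' @ [z]) @ Z)))"
      using Cons Cons.prems by (intro Cons.IH) auto
    ultimately show ?thesis using Cons run.Cons by fastforce
  qed
qed

lemma run_keep: "set Z \<subseteq> C \<Longrightarrow> run (Carry 1) (map Some Z) (Carry 1) (map Some Z)"
  using run_queue[of "[]" Z] by simp

text \<open>The queue initially holds \<open>r\<close>; after the whole block it holds
  \<open>length r\<close> padding letters, whose product is 1. The \<open>K\<close> trailing ones
  supply the room.\<close>

lemma run_insert:
  assumes "set r \<subseteq> C" "set Z \<subseteq> C" "length r \<le> K"
  shows "run (Carry (prod_list r)) (map Some (Z @ replicate K 1)) (Carry 1)
    (map Some (r @ Z @ replicate (K - length r) 1))"
proof -
  let ?Z = "Z @ replicate K 1"
  have "replicate K (1::'m) = replicate (K - length r) 1 @ replicate (length r) 1"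
    using assms(3) by (simp add: replicate_add[symmetric])
  then have "r @ ?Z = (r @ Z @ replicate (K - length r) 1) @ replicate (length r) 1" by simp
  moreover have "length (r @ Z @ replicate (K - length r) 1) = length ?Z" using assms(3) by simp
  ultimately have "take (length ?Z) (r @ ?Z) = r @ Z @ replicate (K - length r) 1"
    "drop (length ?Z) (r @ ?Z) = replicate (length r) 1"
    by (metis append_eq_conv_conj)+
  moreover have "set ?Z \<subseteq> C" using assms(2) one_letter by auto
  ultimately show ?thesis using run_queue[OF assms(1) _ assms(3), of ?Z]
    by (simp only: prod_list_replicate_one)
qed

text \<open>Copy \<open>X\<close>, absorb \<open>L\<close>, then emit \<open>r\<close>: the tape is
  cut into blocks that strip to \<open>x\<close>, \<open>l\<close> and \<open>y\<close>.\<close>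

lemma rewrite_run:
  assumes "rewrite_step C K u v" "set Y \<subseteq> C" "strip Y = strip u"
  obtains Y' where "set Y' \<subseteq> C" "strip Y' = strip v"
    "run (Carry 1) (map Some (Y @ replicate K 1)) (Carry 1) (map Some Y')"
proof -
  obtain x l r y where rw: "u = x @ l @ y" "v = x @ r @ y" "set l \<subseteq> C" "set r \<subseteq> C"
    "length l \<le> K" "length r \<le> K" "prod_list l = prod_list r"
    using assms(1) unfolding rewrite_step_def by blast
  have "strip Y = strip x @ strip l @ strip y" using assms(3) rw(1) by simp
  then obtain X L Z where Y: "Y = X @ L @ Z" "strip X = strip x" "strip L = strip l" "strip Z = strip y"
    by (metis filter_append_split)
  have sub: "set X \<subseteq> C" "set L \<subseteq> C" "set Z \<subseteq> C" using assms(2) Y(1) by auto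
  have "length (strip L) \<le> K" using Y(3) rw(5) length_filter_le[of _ l] by (metis le_trans)
  then have "run (Carry 1) (map Some L) (Carry (prod_list L)) (map Some (replicate (length L) 1))"
    using run_absorb[of "[]" L] sub by simp
  \<comment> \<open>The carried element was built from \<open>L\<close> but can now be read as a
    queue holding \<open>r\<close>; this is where the relation is applied.\<close>
  moreover have "prod_list L = prod_list r" using Y(3) rw(7) prod_list_strip by metis
  ultimately have "run (Carry 1) (map Some L) (Carry (prod_list r)) (map Some (replicate (length L) 1))" by simp
  from run_append[OF run_append[OF run_keep[OF sub(1)] this] run_insert[OF rw(4) sub(3) rw(6)]]
  have "run (Carry 1) (map Some (Y @ replicate K 1)) (Carry 1)
      (map Some (X @ replicate (length L) 1 @ r @ Z @ replicate (K - length r) 1))"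
    by (simp add: Y(1))
  moreover have "strip (X @ replicate (length L) 1 @ r @ Z @ replicate (K - length r) 1) = strip v"
    using Y rw(2) by simp
  moreover have "set (X @ replicate (length L) 1 @ r @ Z @ replicate (K - length r) 1) \<subseteq> C"
    using sub rw(4) one_letter by auto
  ultimately show thesis using that by blast
qed

text \<open>Each rewriting step uses up \<open>K\<close> cells of the trailing padding, hence the
  supply \<open>K * j\<close>. The word on the tape agrees with the derived word only up to
  padding.\<close>

lemma rewrite_sweeps:
  assumes "set X \<subseteq> C"
  shows "(rewrite_step C K ^^ j) u v \<Longrightarrow> set Y \<subseteq> C \<Longrightarrow> strip Y = strip u \<Longrightarrow>
    \<exists>Y'. set Y' \<subseteq> C \<and> strip Y' = strip v \<and>
      (sweep ^^ j) (map Some X @ None # map Some (Y @ replicate (K * j) 1)) (map Some X @ None # map Some Y')"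
proof (induction j arbitrary: u Y)
  case 0
  then show ?case by auto
next
  case (Suc j)
  obtain u1 where u1: "rewrite_step C K u u1" "(rewrite_step C K ^^ j) u1 v"
    using Suc.prems(1) by (metis relpowp_Suc_D2)
  obtain Y1 where Y1: "set Y1 \<subseteq> C" "strip Y1 = strip u1"
    "run (Carry 1) (map Some (Y @ replicate K 1)) (Carry 1) (map Some Y1)"
    using rewrite_run[OF u1(1) Suc.prems(2,3)] by metis
  let ?E = "replicate (K * j) (1::'m)"
  have "run Seek (map Some X) Seek (map Some X)" using assms by (intro run_loop) (auto intro: forward.seek)
  moreover have "run (Carry 1) (map Some ((Y @ replicate K 1) @ ?E)) (Carry 1) (map Some (Y1 @ ?E))"
    unfolding map_append using Y1(3) one_letter
    by (intro run_append[OF Y1(3)[unfolded map_append]] run_keep[unfolded map_append]) auto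
  ultimately have r: "run Seek (map Some X @ None # map Some ((Y @ replicate K 1) @ ?E)) (Carry 1)
      (map Some X @ None # map Some (Y1 @ ?E))"
    using run.Cons[OF forward.seek_sep] run_append by blast
  have "set (map Some X @ None # map Some (Y1 @ ?E)) \<subseteq> insert None (Some ` C)"
    using assms Y1(1) one_letter by auto
  then have "sweep (map Some X @ None # map Some ((Y @ replicate K 1) @ ?E)) (map Some X @ None # map Some (Y1 @ ?E))"
    unfolding sweep_def using r by blast
  moreover obtain Y' where Y': "set Y' \<subseteq> C" "strip Y' = strip v"
    "(sweep ^^ j) (map Some X @ None # map Some (Y1 @ ?E)) (map Some X @ None # map Some Y')"
    using Suc.IH[OF u1(2) Y1(1,2)] by blast
  ultimately have "(sweep ^^ Suc j) (map Some X @ None # map Some ((Y @ replicate K 1) @ ?E))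
      (map Some X @ None # map Some Y')"
    by (metis relpowp_Suc_I2)
  moreover have "(Y @ replicate K 1) @ ?E = Y @ replicate (K * Suc j) 1" by (simp add: replicate_add)
  ultimately show ?case using Y' by (simp only:) blast
qed

lemma strip_Cons_split:
  assumes "strip X = a # w"
  obtains U X' where "X = U @ a # X'" "set U \<subseteq> {1}" "strip X' = w" "a \<noteq> 1"
proof -
  obtain U X' where "X = U @ a # X'" "\<forall>u\<in>set U. u = 1" "a \<noteq> 1" "w = strip X'"
    using assms unfolding filter_eq_Cons_iff by auto
  then show thesis using that[of U X'] by blast
qed

text \<open>Each sweep replaces the first non-identity letter on both sides by 1, so it removes the
  head of the common stripped word.\<close>

lemma cancel_sweeps:
  "strip X = w \<Longrightarrow> strip Y = w \<Longrightarrow> set X \<subseteq> C \<Longrightarrow> set Y \<subseteq> C \<Longrightarrow>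
    \<exists>X' Y'. set X' \<subseteq> {1} \<and> set Y' \<subseteq> {1} \<and>
      (sweep ^^ length w) (map Some X @ None # map Some Y) (map Some X' @ None # map Some Y')"
proof (induction w arbitrary: X Y)
  case Nil
  then have "set X \<subseteq> {1}" "set Y \<subseteq> {1}" by (auto simp: filter_empty_conv)
  then show ?case by auto
next
  case (Cons a w)
  obtain U X1 where X: "X = U @ a # X1" "set U \<subseteq> {1}" "strip X1 = w" "a \<noteq> 1"
    using strip_Cons_split[OF Cons.prems(1)] .
  obtain V Y1 where Y: "Y = V @ a # Y1" "set V \<subseteq> {1}" "strip Y1 = w"
    using strip_Cons_split[OF Cons.prems(2)] .
  have a: "a \<in> C" and sub: "set X1 \<subseteq> C" "set Y1 \<subseteq> C" using X(1) Y(1) Cons.prems by auto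
  define X2 Y2 where "X2 = U @ 1 # X1" and "Y2 = V @ 1 # Y1"
  have "run Pick (map Some U) Pick (map Some U)"
    using X(2) by (intro run_loop) (auto intro: forward.pick_one)
  moreover have "run (Bring a) (map Some X1) (Bring a) (map Some X1)"
    using sub(1) a by (intro run_loop) (auto intro: forward.bring)
  moreover have "run (Match a) (map Some V) (Match a) (map Some V)"
    using Y(2) a by (intro run_loop) (auto intro: forward.match_one)
  moreover note run_keep[OF sub(2)]
  ultimately have "run Pick (map Some U @ Some a # map Some X1 @ None # map Some V @ Some a # map Some Y1) (Carry 1)
      (map Some U @ Some 1 # map Some X1 @ None # map Some V @ Some 1 # map Some Y1)"
    by (blast intro: run_append run.Cons forward.pick[OF a] forward.bring_sep[OF a] forward.match[OF a])
  then have r: "run Pick (map Some X @ None # map Some Y) (Carry 1) (map Some X2 @ None # map Some Y2)"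
    unfolding X(1) Y(1) X2_def Y2_def by simp
  have sub2: "set X2 \<subseteq> C" "set Y2 \<subseteq> C" using X(1) Y(1) Cons.prems one_letter unfolding X2_def Y2_def by auto
  then have "sweep (map Some X @ None # map Some Y) (map Some X2 @ None # map Some Y2)"
    using r unfolding sweep_def by auto
  moreover have "strip X2 = w" "strip Y2 = w"
    using X Y unfolding X2_def Y2_def by (auto simp: filter_empty_conv)
  then obtain X' Y' where "set X' \<subseteq> {1}" "set Y' \<subseteq> {1}"
    "(sweep ^^ length w) (map Some X2 @ None # map Some Y2) (map Some X' @ None # map Some Y')"
    using Cons.IH sub2 by blast
  ultimately show ?case using relpowp_Suc_I2 by (metis length_Cons)
qed

text \<open>The second word is rewritten into the first, then the two are cancelled letter by
  letter. Sweeps, initial padding and final check amount to at most \<open>j + d + 2\<close> phases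
  of at most \<open>2 * length T + 2\<close> steps.\<close>

lemma accepting_complete:
  assumes "set u \<subseteq> C" "set v \<subseteq> C" "derives C K n v u"
    and w: "w = map Some u @ None # map Some v"
  shows "\<exists>k c. k \<le> (n + length w + 2) * (2 * (length w + K * n) + 2) \<and>
    (step ^^ k) (Pad, tape_of w, 0) c \<and> fst c = Accept"
proof -
  obtain j where j: "j \<le> n" "(rewrite_step C K ^^ j) v u" using assms(3) unfolding derives_def by blast
  \<comment> \<open>All padding is provided before the first sweep, since sweeps never change the
    tape length.\<close>
  define T where "T = w @ replicate (K * j) (Some 1)"
  have T: "T = map Some u @ None # map Some (v @ replicate (K * j) 1)" unfolding T_def w by simp
  have "set w \<subseteq> insert None (Some ` C)" using assms(1,2) unfolding w by auto
  from init_steps[OF this, of "K * j"]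
  have i: "(step ^^ (2 * length T + 1)) (Pad, tape_of w, 0) (Rewind, tape_of T, -1)" unfolding T_def by simp
  obtain Y where Y: "set Y \<subseteq> C" "strip Y = strip u" "(sweep ^^ j) T (map Some u @ None # map Some Y)"
    using rewrite_sweeps[OF assms(1) j(2) assms(2)] unfolding T by blast
  define d where "d = length (strip u)"
  obtain X' Y' where X': "set X' \<subseteq> {1}" "set Y' \<subseteq> {1}"
    "(sweep ^^ d) (map Some u @ None # map Some Y) (map Some X' @ None # map Some Y')"
    using cancel_sweeps[OF refl Y(2) assms(1) Y(1)] unfolding d_def by blast
  define T' where "T' = map Some X' @ None # map Some Y'"
  have "(sweep ^^ (j + d)) T T'" using Y(3) X'(3) unfolding T'_def by (rule relpowp_trans)
  from sweeps_steps[OF this]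
  have m: "length T' = length T" "(step ^^ ((j + d) * (2 * length T + 2))) (Rewind, tape_of T, -1) (Rewind, tape_of T', -1)"
    by blast+
  have "(step ^^ (length T + 2)) (Rewind, tape_of T', -1) (Accept, tape_of T', int (length T))"
    using check_steps[OF X'(1,2) T'_def] m(1) by simp
  from relpowp_trans[OF relpowp_trans[OF i m(2)] this]
  have "(step ^^ (2 * length T + 1 + (j + d) * (2 * length T + 2) + (length T + 2))) (Pad, tape_of w, 0)
      (Accept, tape_of T', int (length T))" .
  moreover have "2 * length T + 1 + (j + d) * (2 * length T + 2) + (length T + 2) \<le>
      (n + length w + 2) * (2 * (length w + K * n) + 2)"
  proof -
    have "2 * length T + 1 + (j + d) * (2 * length T + 2) + (length T + 2) \<le> (j + d + 2) * (2 * length T + 2)"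
      by (simp add: algebra_simps)
    moreover have "j + d + 2 \<le> n + length w + 2"
      using j(1) length_filter_le[of "\<lambda>a. a \<noteq> 1" u]
      unfolding d_def w length_append length_map by linarith
    moreover have "2 * length T + 2 \<le> 2 * (length w + K * n) + 2" unfolding T_def using j(1) by simp
    ultimately show ?thesis by (meson le_trans mult_le_mono)
  qed
  ultimately show ?thesis by (metis fst_conv)
qed

end

section \<open>The word problem\<close>

theorem theorem5p7:
  fixes A :: "'m::monoid_mult set" and \<delta> :: real
  assumes "\<forall>a b c::'m. a * b = a * c \<longrightarrow> b = c"
    and "finite A" and "generates A"
    and "\<delta> \<ge> 0" and "strongly_hyperbolic A \<delta>"
  shows "\<forall>B::'m set. finite B \<and> generates B \<longrightarrow> in_NP (Some ` B \<union> {None}) (word_problem B)"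
proof (intro allI impI, elim conjE)
  fix B :: "'m set"
  assume "finite B"
  interpret thin_triangles A \<delta> using assms by unfold_locales auto
  \<comment> \<open>Derivations pass through geodesic words over \<open>A\<close> even though the
    input is over \<open>B\<close>, and the padding letter 1 must be available.\<close>
  define C where "C = insert 1 (A \<union> B)"
  have C: "finite C" "A \<subseteq> C" "B \<subseteq> C" "1 \<in> C" unfolding C_def using \<open>finite A\<close> \<open>finite B\<close> by auto
  obtain K c where short_derivation: "\<And>u v. set u \<subseteq> C \<Longrightarrow> set v \<subseteq> C \<Longrightarrow> prod_list u = prod_list v \<Longrightarrow>
       derives C K (c * (length u + length v + 1) ^ 7) u v"
    using polynomial_derivations[OF C(1,2)] by blast
  interpret rewriting_machine C K using C by unfold_locales auto
  let ?\<Sigma> = "Some ` B \<union> {None}"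
  \<comment> \<open>With \<open>y\<close> the input length, both the number of sweeps and the length
    of the padded tape are of order \<open>y ^ 7\<close>, which gives degree 14.\<close>
  have bound: "(c * y ^ 7 + y + 2) * (2 * (y + K * (c * y ^ 7)) + 2) \<le> ((c + 2) * (2 + 2 * K * c)) * (y + 1) ^ 14"
    for y :: nat
  proof -
    define z where "z = (y + 1) ^ 7"
    have z: "y ^ 7 \<le> z" "y + 1 \<le> z"
      using power_mono[of y "y + 1" 7] self_le_power[of "y + 1" 7] unfolding z_def by auto
    have "c * y ^ 7 + y + 2 \<le> (c + 2) * z"
      using mult_le_mono2[OF z(1), of c] z(2) by (simp only: distrib_right)
    moreover have "2 * (y + K * (c * y ^ 7)) + 2 \<le> (2 + 2 * K * c) * z"
      using mult_le_mono2[OF z(1), of "2 * K * c"] z(2)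
      by (simp only: distrib_right distrib_left mult.assoc)
    ultimately have "(c * y ^ 7 + y + 2) * (2 * (y + K * (c * y ^ 7)) + 2) \<le> ((c + 2) * z) * ((2 + 2 * K * c) * z)"
      by (rule mult_le_mono)
    moreover have "((c + 2) * z) * ((2 + 2 * K * c) * z) = ((c + 2) * (2 + 2 * K * c)) * (z * z)"
      by (simp only: ac_simps)
    moreover have "z * z = (y + 1) ^ 14" unfolding z_def power_add[symmetric] by simp
    ultimately show ?thesis by (simp only:)
  qed
  show "in_NP ?\<Sigma> (word_problem B)"
  proof (rule in_NP_machine[of states "insert None (Some ` C)" Pad "{Accept}" ?\<Sigma> transitions _
        "(c + 2) * (2 + 2 * K * c)" 14])
    show "finite states" unfolding states_def using finite_C finite_S by simp
    show "finite (insert None (Some ` C))" using C(1) by simp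
    show "Pad \<in> states" "{Accept} \<subseteq> states" unfolding states_def by simp_all
    show "?\<Sigma> \<subseteq> insert None (Some ` C)" using C(3) by blast
    show "transitions \<subseteq> states \<times> insert None (Some ` insert None (Some ` C)) \<times> states \<times>
        insert None (Some ` insert None (Some ` C)) \<times> {-1, 0, 1}" by (rule transitions_closed)
  next
    fix w k c assume w: "w \<in> lists ?\<Sigma>" and run: "(step ^^ k) (Pad, tape_of w, 0) c" "fst c \<in> {Accept}"
    have "balanced w" using accepting_sound[OF run(1)] run(2) by simp
    then obtain u v where uv: "w = map Some u @ None # map Some v" "prod_list u = prod_list v"
      unfolding balanced_def by blast
    have "set u \<subseteq> B" "set v \<subseteq> B" using w unfolding uv(1) by auto
    then show "w \<in> word_problem B" unfolding word_problem_def using uv by auto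
  next
    fix w assume "w \<in> word_problem B"
    then obtain u v where uv: "w = map Some u @ None # map Some v" "set u \<subseteq> B" "set v \<subseteq> B"
      "prod_list u = prod_list v" unfolding word_problem_def by auto
    have sub: "set u \<subseteq> C" "set v \<subseteq> C" using uv(2,3) C(3) by auto
    \<comment> \<open>The separator accounts for the summand 1, so the bound of
      \<open>short_derivation\<close> is exactly a power of the input length.\<close>
    have len: "length v + length u + 1 = length w" unfolding uv(1) by simp
    have "derives C K (c * length w ^ 7) v u"
      using short_derivation[OF sub(2,1)] uv(4) len by simp
    from accepting_complete[OF sub this uv(1)] obtain k x where
      "k \<le> (c * length w ^ 7 + length w + 2) * (2 * (length w + K * (c * length w ^ 7)) + 2)"
      "(step ^^ k) (Pad, tape_of w, 0) x" "fst x = Accept" by blast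
    then show "\<exists>k x. k \<le> (c + 2) * (2 + 2 * K * c) * (length w + 1) ^ 14 \<and>
        (step ^^ k) (Pad, tape_of w, 0) x \<and> fst x \<in> {Accept}"
      using le_trans[OF _ bound] by blast
  qed
qed

end
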